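(* Consider the normal, misère and escape games on Galton-Watson trees. (i) Binary branching. Let $(p_0,p_1,p_2)=(1-t,0,t)$ for $t\in[0,1]$. With $t_n:=\sqrt3/2$: $D>0$ if and only if $t>t_n$, and $D\to0$ as $t\downarrow t_n$. With $t_m:=3/4$: $\widetilde D>0$ if and only if $t>t_m$, and $\widetilde D\to 0$ as $t\downarrow t_m$. With $t_e:=3/2^{5/3}$: $E^{(1)}>0$ if and only if $E^{(2)}>0$, which happens if and only if $t\ge t_e$ (so the phase transition of the escape game is discontinuous); moreover $E^{(1)}=2^{4/3}/3$ at $t=t_e$. (ii) Poisson offspring. Let the offspring distribution be Poisson with mean $\lambda>0$. The normal and misère games have continuous phase transitions at $\lambda_n=e$ and $\lambda_m=2.103\ldots$ respectively, where $\lambda_m$ is the solution of $\lambda=e^{1-\lambda e^{-\lambda}}$: that is, $D>0$ if and only if $\lambda>\lambda_n$, with $D\to0$ as $\lambda\downarrow\lambda_n$, and $\widetilde D>0$ if and only if $\lambda>\lambda_m$, with $\widetilde D\to0$ as $\lambda\downarrow\lambda_m$. The escape game has a discontinuous phase transition at some $\lambda_e\approx3.319$: $E^{(1)}>0$ if and only if $E^{(2)}>0$, which happens if and only if $\lambda\ge\lambda_e$. (iii) Geometric offspring. Let $p_i=(1-\alpha)\alpha^i$ for $i\ge0$. Then $D=\widetilde D=E^{(1)}=E^{(2)}=0$ for all $\alpha\in(0,1)$.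
   Context: An offspring distribution is a probability mass function $\mathbf p=(p_0,p_1,\dots)$ on $\{0,1,2,\dots\}$. Let $\mathcal T$ be the Galton-Watson tree with offspring distribution $\mathbf p$, with edges directed from parents to children and root $o$. A token starts at $o$, and two players alternately move the token along a directed edge to a child of its current vertex. The tree is fully known to both players. A strategy for a player assigns to every vertex that has a child a legal move; it is winning if it yields a win for that player whatever strategy the opponent uses. Normal game: a player who cannot move loses and the other wins. Misère game: a player who cannot move wins and the other loses. In both, the game is a draw if neither player has a winning strategy. Escape game: the players are Stopper and Escaper; Stopper wins if either player is ever unable to move; the game is a win for Escaper if Stopper has no winning strategy. $D$ and $\widetilde D$ are the probabilities (over $\mathcal T$) that the normal game, respectively the misère game, is a draw. $E^{(1)}$ and $E^{(2)}$ are the probabilities that Escaper wins the escape game when Escaper moves first, respectively second.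
   Formalization: The decimal "2.103…" for the misère Poisson threshold is a rounding (the solution is about 2.10265), so it is stated as within 0.0005 of 2.103, together with its characterization as the unique positive solution of the equation. *)

theory Defs
  imports "HOL-Probability.Probability"
begin

section \<open>Games played with a token on a rooted directed graph\<close>

text \<open>
  A game board is given by a root and the map \<open>C\<close> sending each vertex to the set of its
  children (out-neighbours). On a tree a vertex determines the path leading to it, so
  strategies that only depend on the current vertex are no restriction.
\<close>

datatype player = First | Second

fun opponent :: "player \<Rightarrow> player" where
  "opponent First = Second"
| "opponent Second = First"

definition mover :: "nat \<Rightarrow> player" where
  "mover n = (if even n then First else Second)"

definition is_strategy :: "('v \<Rightarrow> 'v set) \<Rightarrow> ('v \<Rightarrow> 'v) \<Rightarrow> bool" where
  "is_strategy C \<sigma> \<longleftrightarrow> (\<forall>v. C v \<noteq> {} \<longrightarrow> \<sigma> v \<in> C v)"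

text \<open>
  \<open>token C r s n\<close> is the position of the token after \<open>n\<close> moves from \<open>r\<close>, where player \<open>P\<close>
  follows \<open>s P\<close>; it is \<open>None\<close> if the play ended before \<open>n\<close> moves were made.
\<close>

primrec token :: "('v \<Rightarrow> 'v set) \<Rightarrow> 'v \<Rightarrow> (player \<Rightarrow> 'v \<Rightarrow> 'v) \<Rightarrow> nat \<Rightarrow> 'v option" where
  "token C r s 0 = Some r"
| "token C r s (Suc n) =
     (case token C r s n of
        None \<Rightarrow> None
      | Some v \<Rightarrow> if C v = {} then None else Some (s (mover n) v))"

definition stuck :: "('v \<Rightarrow> 'v set) \<Rightarrow> 'v \<Rightarrow> (player \<Rightarrow> 'v \<Rightarrow> 'v) \<Rightarrow> player \<Rightarrow> bool" where
  "stuck C r s Q \<longleftrightarrow> (\<exists>n v. token C r s n = Some v \<and> C v = {} \<and> mover n = Q)"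

text \<open>
  \<open>B\<close> is the set of players \<open>Q\<close> such that \<open>P\<close> wins whenever \<open>Q\<close> is unable to move.
\<close>

definition winning_strategy ::
  "('v \<Rightarrow> 'v set) \<Rightarrow> 'v \<Rightarrow> player \<Rightarrow> player set \<Rightarrow> ('v \<Rightarrow> 'v) \<Rightarrow> bool" where
  "winning_strategy C r P B \<sigma> \<longleftrightarrow>
     is_strategy C \<sigma> \<and>
     (\<forall>\<tau>. is_strategy C \<tau> \<longrightarrow>
        (\<exists>Q\<in>B. stuck C r (\<lambda>R. if R = P then \<sigma> else \<tau>) Q))"

definition normal_draw :: "('v \<Rightarrow> 'v set) \<Rightarrow> 'v \<Rightarrow> bool" where
  "normal_draw C r \<longleftrightarrow> (\<forall>P. \<not> (\<exists>\<sigma>. winning_strategy C r P {opponent P} \<sigma>))"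

definition misere_draw :: "('v \<Rightarrow> 'v set) \<Rightarrow> 'v \<Rightarrow> bool" where
  "misere_draw C r \<longleftrightarrow> (\<forall>P. \<not> (\<exists>\<sigma>. winning_strategy C r P {P} \<sigma>))"

text \<open>The player \<open>P\<close> is Escaper, and \<open>opponent P\<close> is Stopper.\<close>

definition escaper_wins :: "('v \<Rightarrow> 'v set) \<Rightarrow> 'v \<Rightarrow> player \<Rightarrow> bool" where
  "escaper_wins C r P \<longleftrightarrow> \<not> (\<exists>\<sigma>. winning_strategy C r (opponent P) UNIV \<sigma>)"


section \<open>Galton-Watson trees\<close>

text \<open>
  Vertices carry Ulam-Harris labels: the children of \<open>v\<close> are \<open>v @ [0], ..., v @ [k - 1]\<close>,
  where \<open>k\<close> is the number of children. A sample point \<open>\<omega>\<close> assigns a number of children to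
  every label; these numbers are independent with law \<open>p\<close>.
\<close>

type_synonym vertex = "nat list"

definition GW :: "nat pmf \<Rightarrow> (vertex \<Rightarrow> nat) measure" where
  "GW p = (\<Pi>\<^sub>M v\<in>UNIV. measure_pmf p)"

inductive_set gw_tree :: "(vertex \<Rightarrow> nat) \<Rightarrow> vertex set" for \<omega> where
  root: "[] \<in> gw_tree \<omega>"
| child: "v \<in> gw_tree \<omega> \<Longrightarrow> i < \<omega> v \<Longrightarrow> v @ [i] \<in> gw_tree \<omega>"

definition children :: "(vertex \<Rightarrow> nat) \<Rightarrow> vertex \<Rightarrow> vertex set" where
  "children \<omega> v = {w \<in> gw_tree \<omega>. \<exists>i. w = v @ [i]}"

definition D_normal :: "nat pmf \<Rightarrow> real" where
  "D_normal p = \<P>(\<omega> in GW p. normal_draw (children \<omega>) [])"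

definition D_misere :: "nat pmf \<Rightarrow> real" where
  "D_misere p = \<P>(\<omega> in GW p. misere_draw (children \<omega>) [])"

definition E1 :: "nat pmf \<Rightarrow> real" where
  "E1 p = \<P>(\<omega> in GW p. escaper_wins (children \<omega>) [] First)"

definition E2 :: "nat pmf \<Rightarrow> real" where
  "E2 p = \<P>(\<omega> in GW p. escaper_wins (children \<omega>) [] Second)"


section \<open>Binary branching\<close>

definition binary_pmf :: "real \<Rightarrow> nat pmf" where
  "binary_pmf t = map_pmf (\<lambda>b. if b then 2 else 0) (bernoulli_pmf t)"

lemma pmf_binary_pmf:
  assumes "0 \<le> t" "t \<le> 1"
  shows "pmf (binary_pmf t) k = (if k = 0 then 1 - t else if k = 2 then t else 0)"
proof -
  let ?f = "\<lambda>b. if b then 2 else 0 :: nat"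
  have "pmf (binary_pmf t) k = measure (measure_pmf (bernoulli_pmf t)) (?f -` {k})"
    by (simp add: binary_pmf_def pmf_map)
  also have "?f -` {k} = (if k = 0 then {False} else if k = 2 then {True} else {})"
    by (auto split: if_splits)
  finally show ?thesis
    using assms by (simp add: measure_pmf_single)
qed

end

theory Submission
  imports Defs
begin

text \<open>
  By finite branching, a player with a winning strategy can force a win within a bounded number
  of rounds. Splitting the tree at its root, the probabilities of a forced win within \<open>n\<close> rounds
  satisfy a monotone recursion in the generating function \<open>G\<close> of the offspring law, so their limits
  are the least solution of the corresponding fixed point equations. For the normal and misere
  games, with \<open>F x = 1 - G x\<close> and \<open>F x = 1 - G x + G 0\<close>, the draw probability is the largest
  width of a 2-cycle of \<open>F\<close>; for the escape game \<open>(E1, E2)\<close> is the greatest solution of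
  \<open>v = 1 - G (1 - u)\<close>, \<open>u = G v - G 0\<close>. For binary and
  Poisson offspring a positive solution first appears at a tangency, which makes the phase
  transition of the escape game discontinuous.
\<close>

section \<open>Forced wins\<close>

text \<open>Why the draw transitions are continuous and the escape transition is not: a 2-cycle may
  degenerate to a fixed point of \<open>F\<close>, of width 0, and at the critical parameter only
  such degenerate cycles are left, so the draw condition is strict. A positive escape solution
  instead appears at a distance from the trivial solution \<open>E1 = E2 = 0\<close>, so it is
  already present at the critical parameter and the condition is not strict. For Poisson offspring
  neither the cycles nor the escape probabilities have a closed form. Cycles are therefore detected
  through the derivative of \<open>F\<close> iterated twice, the limit of \<open>D\<close> comes
  from compactness, and the escape threshold comes from comparing values of an auxiliary function at
  a local maximum and at the trivial solution. Leastness of the win probabilities is proved against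
  inequalities, not only against solutions. Exhibiting one explicit subsolution of the escape
  equations is then enough for positivity.\<close>

lemma opponent_opponent [simp]: "opponent (opponent P) = P"
  by (cases P) auto

lemma opponent_neq [simp]: "opponent P \<noteq> P" "P \<noteq> opponent P"
  by (cases P; auto)+

lemma neq_player_iff: "Q \<noteq> P \<longleftrightarrow> Q = opponent P"
  by (cases P; cases Q) auto

lemma mover_0 [simp]: "mover 0 = First"
  by (simp add: mover_def)

lemma mover_Suc [simp]: "mover (Suc n) = opponent (mover n)"
  by (simp add: mover_def)

text \<open>Recognising that the mover is stuck costs one round, so the bound 0 forces nothing. The
  win events therefore start from the empty set and the probability recursion starts from 0.\<close>

primrec forces ::
  "('v \<Rightarrow> 'v set) \<Rightarrow> player set \<Rightarrow> player \<Rightarrow> nat \<Rightarrow> player \<Rightarrow> 'v \<Rightarrow> bool" where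
  "forces C B P 0 Q v = False"
| "forces C B P (Suc n) Q v =
     (if C v = {} then Q \<in> B
      else if Q = P then \<exists>w\<in>C v. forces C B P n (opponent Q) w
      else \<forall>w\<in>C v. forces C B P n (opponent Q) w)"

lemma forces_Suc_mono: "forces C B P n Q v \<Longrightarrow> forces C B P (Suc n) Q v"
proof (induction n arbitrary: Q v)
  case (Suc n)
  have "if C v = {} then Q \<in> B
      else if Q = P then \<exists>w\<in>C v. forces C B P n (opponent Q) w
      else \<forall>w\<in>C v. forces C B P n (opponent Q) w"
    using Suc.prems by (simp only: forces.simps)
  then have "if C v = {} then Q \<in> B
      else if Q = P then \<exists>w\<in>C v. forces C B P (Suc n) (opponent Q) w
      else \<forall>w\<in>C v. forces C B P (Suc n) (opponent Q) w"
    by (auto split: if_splits simp del: forces.simps intro: Suc.IH)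
  then show ?case
    by (simp only: forces.simps(2)[of C B P "Suc n"])
qed simp

lemma forces_mono: "m \<le> n \<Longrightarrow> forces C B P m Q v \<Longrightarrow> forces C B P n Q v"
  by (induction n rule: dec_induct) (blast intro: forces_Suc_mono)+

text \<open>Renaming the players is a symmetry of the game. It later turns wins of Second with First
  to move into wins of First with Second to move.\<close>

lemma forces_opponent:
  "forces C (opponent ` B) (opponent P) n (opponent Q) v = forces C B P n Q v"
proof (induction n arbitrary: Q v)
  case (Suc n)
  have "opponent Q \<in> opponent ` B \<longleftrightarrow> Q \<in> B"
    by (metis image_iff opponent_opponent)
  moreover have "opponent Q = opponent P \<longleftrightarrow> Q = P"
    by (metis opponent_opponent)
  ultimately show ?case
    using Suc.IH[of "opponent Q"] by (cases "Q = P") simp_all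
qed simp

text \<open>The strategy moves to a child from which the win is forced in the fewest rounds, so the bound
  decreases along the play; moving to an arbitrary winning child could postpone the win forever.\<close>

lemma winning_strategy_if_forces:
  assumes "forces C B P n First r"
  shows "\<exists>\<sigma>. winning_strategy C r P B \<sigma>"
proof -
  let ?good = "\<lambda>v w. w \<in> C v \<and>
    (\<forall>n. (\<exists>w'\<in>C v. forces C B P n (opponent P) w') \<longrightarrow> forces C B P n (opponent P) w)"
  have ex: "\<exists>w. ?good v w" if "C v \<noteq> {}" for v
  proof (cases "\<exists>n. \<exists>w'\<in>C v. forces C B P n (opponent P) w'")
    case True
    define N where "N = (LEAST n. \<exists>w'\<in>C v. forces C B P n (opponent P) w')"
    obtain w where w: "w \<in> C v" "forces C B P N (opponent P) w"
      using LeastI_ex[OF True] unfolding N_def by blast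
    have "forces C B P n (opponent P) w" if "\<exists>w'\<in>C v. forces C B P n (opponent P) w'" for n
      using Least_le[of "\<lambda>n. \<exists>w'\<in>C v. forces C B P n (opponent P) w'", OF that] w(2)
      unfolding N_def by (rule forces_mono)
    with w(1) show ?thesis by blast
  next
    case False
    with that show ?thesis by blast
  qed
  define \<sigma> where "\<sigma> v = (SOME w. ?good v w)" for v
  have \<sigma>: "?good v (\<sigma> v)" if "C v \<noteq> {}" for v
    using someI_ex[OF ex[OF that]] unfolding \<sigma>_def .
  have "\<exists>Q\<in>B. stuck C r (\<lambda>R. if R = P then \<sigma> else \<tau>) Q" if \<tau>: "is_strategy C \<tau>" for \<tau>
  proof -
    let ?s = "\<lambda>R. if R = P then \<sigma> else \<tau>"
    have "\<exists>Q\<in>B. stuck C r ?s Q"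
      if "token C r ?s k = Some v" "forces C B P n (mover k) v" for n k v
      using that
    proof (induction n arbitrary: k v)
      case (Suc n)
      show ?case
      proof (cases "C v = {}")
        case True
        with Suc.prems(2) have "mover k \<in> B" by simp
        moreover have "stuck C r ?s (mover k)"
          unfolding stuck_def using Suc.prems(1) True by blast
        ultimately show ?thesis ..
      next
        case False
        have "token C r ?s (Suc k) = Some (?s (mover k) v)"
          using False Suc.prems by simp
        moreover have "forces C B P n (mover (Suc k)) (?s (mover k) v)"
        proof (cases "mover k = P")
          case True
          with False Suc.prems(2) have "\<exists>w\<in>C v. forces C B P n (opponent P) w" by simp
          with \<sigma>[OF False] True show ?thesis by simp
        next
          case neq: False
          with False Suc.prems(2) have "\<forall>w\<in>C v. forces C B P n (opponent (mover k)) w" by simp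
          moreover have "\<tau> v \<in> C v" using \<tau> False by (simp add: is_strategy_def)
          ultimately show ?thesis using neq by simp
        qed
        ultimately show ?thesis
          by (rule Suc.IH)
      qed
    qed simp
    from this[of 0 r n] assms show ?thesis by simp
  qed
  moreover have "is_strategy C \<sigma>"
    unfolding is_strategy_def using \<sigma> by blast
  ultimately show ?thesis
    unfolding winning_strategy_def by blast
qed

text \<open>If no bound works at the root, the opponent can stay forever on positions without a
  forced win: \<open>\<tau>\<close> moves to such a child whenever there is one. A stuck position in
  which \<open>P\<close> wins is forced within one round, so the play against \<open>\<tau>\<close>
  never reaches one.\<close>

lemma forces_if_winning_strategy:
  assumes fin: "\<And>v. finite (C v)" and win: "winning_strategy C r P B \<sigma>"
  shows "\<exists>n. forces C B P n First r"
proof (rule ccontr)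
  assume not: "\<nexists>n. forces C B P n First r"
  let ?W = "\<lambda>Q v. \<exists>n. forces C B P n Q v"
  let ?bad = "\<lambda>v w. w \<in> C v \<and> ((\<exists>w'\<in>C v. \<not> ?W P w') \<longrightarrow> \<not> ?W P w)"
  define \<tau> where "\<tau> v = (SOME w. ?bad v w)" for v
  have \<tau>: "?bad v (\<tau> v)" if "C v \<noteq> {}" for v
    using that unfolding \<tau>_def by (intro someI_ex[of "?bad v"]) blast
  \<comment> \<open>Finite branching enters here: the bounds of the children have a maximum, which
    serves all of them at once.\<close>
  have all: "?W (opponent P) v" if ne: "C v \<noteq> {}" and a: "\<forall>w\<in>C v. ?W P w" for v
  proof -
    from a obtain f where f: "forces C B P (f w) P w" if "w \<in> C v" for w
      by metis
    have "forces C B P (Max (f ` C v)) P w" if "w \<in> C v" for w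
      using f[OF that] fin[of v] that by (intro forces_mono[OF Max_ge]) auto
    then have "forces C B P (Suc (Max (f ` C v))) (opponent P) v"
      using ne by auto
    then show ?thesis ..
  qed
  let ?s = "\<lambda>R. if R = P then \<sigma> else \<tau>"
  have \<sigma>: "is_strategy C \<sigma>"
    using win by (simp add: winning_strategy_def)
  have inv: "\<not> ?W (mover k) v" if "token C r ?s k = Some v" for k v
    using that
  proof (induction k arbitrary: v)
    case 0
    with not show ?case by simp
  next
    case (Suc k)
    then obtain u where u: "token C r ?s k = Some u" "C u \<noteq> {}" "v = ?s (mover k) u"
      by (auto split: option.splits if_splits)
    have nW: "\<not> ?W (mover k) u"
      by (rule Suc.IH[OF u(1)])
    show ?case
    proof (cases "mover k = P")
      case True
      have "v \<in> C u"
        using u True \<sigma> by (simp add: is_strategy_def)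
      have "\<not> forces C B P n (opponent P) v" for n
      proof
        assume "forces C B P n (opponent P) v"
        with \<open>v \<in> C u\<close> have "forces C B P (Suc n) P u" by auto
        with nW True show False by blast
      qed
      then show ?thesis using True by simp
    next
      case False
      then have m: "mover k = opponent P"
        by (simp add: neq_player_iff)
      with nW all[OF u(2)] have "\<exists>w\<in>C u. \<not> ?W P w" by auto
      with \<tau>[OF u(2)] u(3) False m show ?thesis by simp
    qed
  qed
  have "is_strategy C \<tau>"
    unfolding is_strategy_def using \<tau> by blast
  with win obtain Q where "Q \<in> B" "stuck C r ?s Q"
    by (auto simp: winning_strategy_def)
  then obtain n v where "token C r ?s n = Some v" "C v = {}" "mover n \<in> B"
    by (auto simp: stuck_def)
  moreover from this have "forces C B P (Suc 0) (mover n) v" by simp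
  ultimately show False using inv by blast
qed

lemma ex_winning_strategy_iff_forces:
  assumes "\<And>v. finite (C v)"
  shows "(\<exists>\<sigma>. winning_strategy C r P B \<sigma>) \<longleftrightarrow> (\<exists>n. forces C B P n First r)"
proof
  assume "\<exists>\<sigma>. winning_strategy C r P B \<sigma>"
  then show "\<exists>n. forces C B P n First r"
    by (elim exE) (rule forces_if_winning_strategy[OF assms])
next
  assume "\<exists>n. forces C B P n First r"
  then show "\<exists>\<sigma>. winning_strategy C r P B \<sigma>"
    by (elim exE) (rule winning_strategy_if_forces)
qed

section \<open>Exclusion of simultaneous wins\<close>

lemma token_None_mono: "m \<le> n \<Longrightarrow> token C r s m = None \<Longrightarrow> token C r s n = None"
  by (induction n rule: dec_induct) auto

lemma stuck_unique:
  assumes "stuck C r s Q" "stuck C r s R"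
  shows "Q = R"
proof -
  have le: "n \<le> m" if "token C r s n = Some v" "token C r s m = Some w" "C w = {}" for n m v w
  proof (rule ccontr)
    assume "\<not> n \<le> m"
    moreover have "token C r s (Suc m) = None" using that by simp
    ultimately show False
      using token_None_mono[of "Suc m" n C r s] that(1) by simp
  qed
  from assms obtain n v m w where
    "token C r s n = Some v" "C v = {}" "mover n = Q"
    "token C r s m = Some w" "C w = {}" "mover m = R"
    by (auto simp: stuck_def)
  with le[of n v m w] le[of m w n v] show ?thesis by simp
qed

text \<open>Let the two strategies play each other: the resulting play would leave both
  \<open>Q\<close> and \<open>opponent Q\<close> stuck, but a play ends at most once.\<close>

lemma not_both_winning_strategy:
  assumes "winning_strategy C r First {Q} \<sigma>" "winning_strategy C r Second {opponent Q} \<tau>"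
  shows False
proof -
  have eq: "(\<lambda>R. if R = First then \<sigma> else \<tau>) = (\<lambda>R. if R = Second then \<tau> else \<sigma>)"
    by (rule ext) (metis player.exhaust player.distinct(1))
  have "stuck C r (\<lambda>R. if R = First then \<sigma> else \<tau>) Q"
    using assms by (simp add: winning_strategy_def)
  moreover have "stuck C r (\<lambda>R. if R = First then \<sigma> else \<tau>) (opponent Q)"
    unfolding eq using assms by (simp add: winning_strategy_def)
  ultimately have "Q = opponent Q"
    by (rule stuck_unique)
  then show False by simp
qed

text \<open>Membership in \<open>gw_tree\<close> is tied to the root and so does not fit well with
  passing to a subtree. Giving successors to every label, inside the tree or not, makes the game
  below \<open>[i]\<close> literally the game of \<open>subtree i \<omega>\<close>; on the tree
  itself nothing changes.\<close>

definition kids :: "(vertex \<Rightarrow> nat) \<Rightarrow> vertex \<Rightarrow> vertex set" where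
  "kids \<omega> v = (\<lambda>i. v @ [i]) ` {..<\<omega> v}"

definition subtree :: "nat \<Rightarrow> (vertex \<Rightarrow> nat) \<Rightarrow> vertex \<Rightarrow> nat" where
  "subtree i \<omega> v = \<omega> (i # v)"

lemma children_eq_kids: "v \<in> gw_tree \<omega> \<Longrightarrow> children \<omega> v = kids \<omega> v"
  by (auto simp: children_def kids_def intro: gw_tree.child elim: gw_tree.cases)

lemma finite_children: "finite (children \<omega> v)"
proof (cases "v \<in> gw_tree \<omega>")
  case True
  then show ?thesis by (simp add: children_eq_kids kids_def)
next
  case False
  then have "children \<omega> v = {}"
    by (auto simp: children_def elim: gw_tree.cases)
  then show ?thesis by simp
qed

lemma forces_children_eq_kids:
  "v \<in> gw_tree \<omega> \<Longrightarrow> forces (children \<omega>) B P n Q v = forces (kids \<omega>) B P n Q v"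
proof (induction n arbitrary: Q v)
  case (Suc n)
  have "w \<in> gw_tree \<omega>" if "w \<in> kids \<omega> v" for w
    using that Suc.prems by (auto simp: kids_def intro: gw_tree.child)
  with Suc show ?case by (simp add: children_eq_kids cong: bex_cong ball_cong)
qed simp

lemma kids_Cons: "kids \<omega> (i # v) = (#) i ` kids (subtree i \<omega>) v"
  by (auto simp: kids_def subtree_def)

lemma forces_kids_Cons:
  "forces (kids \<omega>) B P n Q (i # v) = forces (kids (subtree i \<omega>)) B P n Q v"
  by (induction n arbitrary: Q v) (simp_all add: kids_Cons)

definition win_event :: "player set \<Rightarrow> player \<Rightarrow> nat \<Rightarrow> player \<Rightarrow> (vertex \<Rightarrow> nat) set" where
  "win_event B P n Q = {\<omega>. forces (kids \<omega>) B P n Q []}"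

lemma ex_winning_strategy_iff:
  "(\<exists>\<sigma>. winning_strategy (children \<omega>) [] P B \<sigma>) \<longleftrightarrow> \<omega> \<in> (\<Union>n. win_event B P n First)"
  by (simp add: ex_winning_strategy_iff_forces finite_children forces_children_eq_kids
      gw_tree.root win_event_def)

lemma win_event_0: "win_event B P 0 Q = {}"
  by (simp add: win_event_def)

lemma win_event_Suc_self:
  "win_event B P (Suc n) P =
    {\<omega>. \<exists>i<\<omega> []. subtree i \<omega> \<in> win_event B P n (opponent P)} \<union> {\<omega>. \<omega> [] = 0 \<and> P \<in> B}"
  by (auto simp: win_event_def kids_def forces_kids_Cons lessThan_empty_iff)

lemma win_event_Suc_opponent:
  "win_event B P (Suc n) (opponent P) =
    {\<omega>. \<forall>i<\<omega> []. subtree i \<omega> \<in> win_event B P n P} - {\<omega>. \<omega> [] = 0 \<and> opponent P \<notin> B}"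
  by (auto simp: win_event_def kids_def forces_kids_Cons lessThan_empty_iff)

lemma incseq_win_event: "incseq (\<lambda>n. win_event B P n Q)"
  by (auto simp: incseq_def win_event_def intro: forces_mono)

lemma win_event_opponent:
  "win_event (opponent ` B) (opponent P) n (opponent Q) = win_event B P n Q"
  by (simp add: win_event_def forces_opponent)

section \<open>The Galton-Watson tree\<close>

definition pgf :: "nat pmf \<Rightarrow> real \<Rightarrow> real" where
  "pgf p x = (\<Sum>k. pmf p k * x ^ k)"

lemma sums_pmf_nat: "pmf p sums 1" for p :: "nat pmf"
proof -
  have "(\<lambda>k. measure (measure_pmf p) {k}) sums measure (measure_pmf p) (\<Union>k. {k})"
    by (rule finite_measure.finite_measure_UNION) (auto simp: disjoint_family_on_def)
  then show ?thesis
    by (simp add: measure_pmf_single measure_pmf.prob_space[simplified])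
qed

lemma summable_pgf:
  assumes "0 \<le> x" "x \<le> 1"
  shows "summable (\<lambda>k. pmf p k * x ^ k)"
proof (rule summable_comparison_test)
  show "summable (pmf p)" by (rule sums_summable[OF sums_pmf_nat])
  show "\<exists>N. \<forall>k\<ge>N. norm (pmf p k * x ^ k) \<le> pmf p k"
    using assms by (auto simp: abs_mult mult_left_le power_le_one)
qed

lemma pgf_0: "pgf p 0 = pmf p 0"
  using powser_zero[of "pmf p"] by (simp add: pgf_def)

lemma pgf_1: "pgf p 1 = 1"
  using sums_unique[OF sums_pmf_nat[of p]] by (simp add: pgf_def)

lemma pgf_mono:
  assumes "0 \<le> x" "x \<le> y" "y \<le> 1"
  shows "pgf p x \<le> pgf p y"
  unfolding pgf_def using assms
  by (intro suminf_le summable_pgf mult_left_mono power_mono) auto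

lemma continuous_on_pgf: "continuous_on {0..1} (pgf p)"
proof -
  have "uniform_limit {0..1} (\<lambda>n x. \<Sum>k<n. pmf p k * x ^ k) (\<lambda>x. \<Sum>k. pmf p k * x ^ k) sequentially"
    by (rule Weierstrass_m_test[of _ _ "pmf p"])
      (auto simp: abs_mult mult_left_le power_le_one intro: sums_summable[OF sums_pmf_nat])
  then show ?thesis
    unfolding pgf_def[abs_def]
    by (rule uniform_limit_theorem[rotated]) (auto intro!: always_eventually continuous_intros)
qed

section \<open>Independence of the root and its subtrees\<close>

lemma space_GW [simp]: "space (GW p) = UNIV"
  by (simp add: GW_def space_PiM)

lemma prob_space_GW: "prob_space (GW p)"
  unfolding GW_def by (intro prob_space_PiM measure_pmf.prob_space_axioms)

lemma measurable_GW_component [measurable]: "(\<lambda>\<omega>. \<omega> v) \<in> measurable (GW p) (count_space UNIV)"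
  unfolding GW_def by measurable

lemma measurable_subtree [measurable]: "subtree i \<in> measurable (GW p) (GW p)"
  unfolding GW_def subtree_def[abs_def]
  using measurable_component_singleton[of "i # _" UNIV "\<lambda>_. measure_pmf p"]
  by (intro measurable_PiM_single') (auto simp: space_PiM)

lemma distr_subtree: "distr (GW p) (GW p) (subtree i) = GW p"
  using distr_PiM_reindex[of UNIV "\<lambda>_. measure_pmf p" "Cons i" UNIV]
  by (simp add: GW_def subtree_def[abs_def] measure_pmf.prob_space_axioms restrict_def)

lemma prob_subtree: "A \<in> sets (GW p) \<Longrightarrow> measure (GW p) (subtree i -` A) = measure (GW p) A"
  using measure_distr[OF measurable_subtree, of A p i] by (simp add: distr_subtree)

lemma prob_root: "measure (GW p) {\<omega>. \<omega> [] = k} = pmf p k"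
proof -
  have "distr (GW p) (measure_pmf p) (\<lambda>\<omega>. \<omega> []) = measure_pmf p"
    unfolding GW_def by (rule distr_PiM_component) (auto simp: measure_pmf.prob_space_axioms)
  moreover have "measure (distr (GW p) (measure_pmf p) (\<lambda>\<omega>. \<omega> [])) {k} = measure (GW p) {\<omega>. \<omega> [] = k}"
    by (subst measure_distr) (auto simp: vimage_def)
  ultimately show ?thesis by (simp add: measure_pmf_single)
qed

lemma indep_vars_GW: "prob_space.indep_vars (GW p) (\<lambda>_. measure_pmf p) (\<lambda>v \<omega>. \<omega> v) UNIV"
proof -
  interpret prob_space "GW p" by (rule prob_space_GW)
  have *: "distr (GW p) (measure_pmf p) (\<lambda>\<omega>. \<omega> v) = measure_pmf p" for v
    unfolding GW_def by (rule distr_PiM_component) (auto simp: measure_pmf.prob_space_axioms)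
  show ?thesis
    by (subst indep_vars_iff_distr_eq_PiM)
      (simp_all add: * restrict_UNIV distr_id2 GW_def[symmetric] cong: measurable_cong_sets)
qed

text \<open>The branching property. The number of children and the subtrees read disjoint blocks of
  coordinates: \<open>K None\<close> holds the root, \<open>K (Some i)\<close> the labels that begin
  with \<open>i\<close>. Blocks of independent coordinates are independent, and each subtree again
  has law \<open>GW p\<close>.\<close>

lemma prob_root_subtrees:
  assumes A: "A \<in> sets (GW p)"
  shows "measure (GW p) {\<omega>. \<omega> [] = k \<and> (\<forall>i<k. subtree i \<omega> \<in> A)} = pmf p k * measure (GW p) A ^ k"
proof -
  interpret prob_space "GW p" by (rule prob_space_GW)
  define K where "K j = (case j of None \<Rightarrow> {[]} | Some i \<Rightarrow> range ((#) i))" for j :: "nat option"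
  define X where "X j \<omega> = restrict \<omega> (K j)" for j and \<omega> :: "vertex \<Rightarrow> nat"
  define S where "S j = (case j of None \<Rightarrow> {x \<in> space (\<Pi>\<^sub>M v\<in>K j. measure_pmf p). x [] = k}
      | Some i \<Rightarrow> {x \<in> space (\<Pi>\<^sub>M v\<in>K j. measure_pmf p). subtree i x \<in> A})" for j
  have ind: "indep_vars (\<lambda>j. \<Pi>\<^sub>M v\<in>K j. measure_pmf p) X UNIV"
    unfolding X_def
    by (rule indep_vars_restrict[OF indep_vars_GW, of UNIV K, simplified restrict_def[symmetric], simplified])
      (auto simp: disjoint_family_on_def K_def split: option.splits)
  have S: "S j \<in> sets (\<Pi>\<^sub>M v\<in>K j. measure_pmf p)" for j
  proof (cases j)
    case None
    then show ?thesis
      unfolding S_def by (auto simp: K_def intro!: sets_Collect_single')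
  next
    case (Some i)
    have "subtree i \<in> measurable (\<Pi>\<^sub>M v\<in>K j. measure_pmf p) (GW p)"
      unfolding GW_def subtree_def[abs_def]
      using measurable_component_singleton[of "i # _" "K j" "\<lambda>_. measure_pmf p"]
      by (intro measurable_PiM_single') (auto simp: space_PiM K_def Some)
    from measurable_sets[OF this A] show ?thesis
      by (simp add: S_def Some vimage_def Int_def conj_commute)
  qed
  have X_None: "X None -` S None \<inter> space (GW p) = {\<omega>. \<omega> [] = k}"
    by (auto simp: X_def S_def K_def space_PiM)
  have X_Some: "X (Some i) -` S (Some i) \<inter> space (GW p) = subtree i -` A" for i
  proof -
    have "subtree i (X (Some i) \<omega>) = subtree i \<omega>" for \<omega>
      by (auto simp: X_def K_def subtree_def)
    then show ?thesis by (auto simp: S_def space_PiM) (auto simp: X_def)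
  qed
  have "{\<omega>. \<omega> [] = k \<and> (\<forall>i<k. subtree i \<omega> \<in> A)} =
      (\<Inter>j\<in>insert None (Some ` {..<k}). X j -` S j \<inter> space (GW p))"
    using X_None X_Some by auto
  also have "prob \<dots> = (\<Prod>j\<in>insert None (Some ` {..<k}). prob (X j -` S j \<inter> space (GW p)))"
    using S by (intro indep_varsD[OF ind]) auto
  also have "\<dots> = prob {\<omega>. \<omega> [] = k} * (\<Prod>i<k. prob (subtree i -` A))"
    unfolding X_None[symmetric] X_Some[symmetric]
    by (subst prod.insert) (auto simp: prod.reindex)
  finally show ?thesis
    by (simp add: prob_root prob_subtree[OF A])
qed

lemma sets_GW_all_subtrees:
  assumes A: "A \<in> sets (GW p)"
  shows "{\<omega>. \<forall>i<\<omega> []. subtree i \<omega> \<in> A} \<in> sets (GW p)"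
proof -
  have "Measurable.pred (GW p) (\<lambda>\<omega>. \<forall>i\<in>{..<\<omega> []}. subtree i \<omega> \<in> A)"
    using A by measurable
  then show ?thesis by (simp add: pred_def Ball_def)
qed

lemma prob_all_subtrees:
  assumes A: "A \<in> sets (GW p)"
  shows "measure (GW p) {\<omega>. \<forall>i<\<omega> []. subtree i \<omega> \<in> A} = pgf p (measure (GW p) A)"
proof -
  interpret prob_space "GW p" by (rule prob_space_GW)
  let ?S = "\<lambda>k. {\<omega>. \<omega> [] = k \<and> (\<forall>i<k. subtree i \<omega> \<in> A)}"
  have "?S k \<in> sets (GW p)" for k
  proof -
    have "Measurable.pred (GW p) (\<lambda>\<omega>. \<omega> [] = k \<and> (\<forall>i\<in>{..<k}. subtree i \<omega> \<in> A))"
      using A by measurable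
    then show ?thesis by (simp add: pred_def Ball_def)
  qed
  then have "(\<lambda>k. prob (?S k)) sums prob (\<Union>k. ?S k)"
    by (intro finite_measure_UNION) (auto simp: disjoint_family_on_def)
  moreover have "(\<Union>k. ?S k) = {\<omega>. \<forall>i<\<omega> []. subtree i \<omega> \<in> A}"
    by auto
  ultimately show ?thesis
    unfolding prob_root_subtrees[OF A] pgf_def by (simp add: sums_iff)
qed

lemma prob_ex_subtree:
  assumes A: "A \<in> sets (GW p)"
  shows "measure (GW p) {\<omega>. \<exists>i<\<omega> []. subtree i \<omega> \<in> A} = 1 - pgf p (1 - measure (GW p) A)"
proof -
  interpret prob_space "GW p" by (rule prob_space_GW)
  have A': "UNIV - A \<in> sets (GW p)" "prob (UNIV - A) = 1 - prob A"
    using A sets.compl_sets[OF A] prob_compl[OF A] by auto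
  have "{\<omega>. \<exists>i<\<omega> []. subtree i \<omega> \<in> A} = space (GW p) - {\<omega>. \<forall>i<\<omega> []. subtree i \<omega> \<in> UNIV - A}"
    by auto
  then show ?thesis
    using prob_compl[OF sets_GW_all_subtrees[OF A'(1)]] prob_all_subtrees[OF A'(1)] A'(2) by simp
qed

lemma sets_GW_ex_subtree:
  assumes A: "A \<in> sets (GW p)"
  shows "{\<omega>. \<exists>i<\<omega> []. subtree i \<omega> \<in> A} \<in> sets (GW p)"
proof -
  have "UNIV - A \<in> sets (GW p)" using sets.compl_sets[OF A] by simp
  from sets.compl_sets[OF sets_GW_all_subtrees[OF this]]
  have "UNIV - {\<omega>. \<forall>i<\<omega> []. subtree i \<omega> \<in> UNIV - A} \<in> sets (GW p)" by simp
  also have "UNIV - {\<omega>. \<forall>i<\<omega> []. subtree i \<omega> \<in> UNIV - A} = {\<omega>. \<exists>i<\<omega> []. subtree i \<omega> \<in> A}"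
    by auto
  finally show ?thesis .
qed

lemma sets_GW_root: "{\<omega>. \<omega> [] = k} \<in> sets (GW p)"
proof -
  have "Measurable.pred (GW p) (\<lambda>\<omega>. \<omega> [] = k)" by measurable
  then show ?thesis by (simp add: pred_def)
qed

lemma sets_win_event: "win_event B P n Q \<in> sets (GW p)"
proof (induction n arbitrary: Q)
  case (Suc n)
  have r: "{\<omega>. \<omega> [] = 0 \<and> b} \<in> sets (GW p)" for b
    using sets_GW_root[of 0 p] by (cases b) auto
  show ?case
  proof (cases "Q = P")
    case True
    then show ?thesis
      using sets_GW_ex_subtree[OF Suc.IH] r by (simp add: win_event_Suc_self)
  next
    case False
    then have "Q = opponent P" by (simp add: neq_player_iff)
    then show ?thesis
      using sets_GW_all_subtrees[OF Suc.IH] r by (simp add: win_event_Suc_opponent sets.Diff)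
  qed
qed (simp add: win_event_0)

text \<open>The terms \<open>pmf p 0\<close> correct for a childless root, where the condition on the children fails
  for \<open>\<exists>\<close> and holds vacuously for \<open>\<forall>\<close>.\<close>

lemma prob_win_event_Suc_self:
  "measure (GW p) (win_event B P (Suc n) P) =
    1 - pgf p (1 - measure (GW p) (win_event B P n (opponent P))) + (if P \<in> B then pmf p 0 else 0)"
proof -
  interpret prob_space "GW p" by (rule prob_space_GW)
  let ?E = "{\<omega>. \<exists>i<\<omega> []. subtree i \<omega> \<in> win_event B P n (opponent P)}"
  show ?thesis
  proof (cases "P \<in> B")
    case True
    have "prob (?E \<union> {\<omega>. \<omega> [] = 0}) = prob ?E + prob {\<omega>. \<omega> [] = 0}"
      by (intro finite_measure_Union sets_GW_ex_subtree sets_win_event sets_GW_root) auto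
    with True show ?thesis
      by (simp add: win_event_Suc_self prob_ex_subtree sets_win_event prob_root)
  qed (simp add: win_event_Suc_self prob_ex_subtree sets_win_event)
qed

lemma prob_win_event_Suc_opponent:
  "measure (GW p) (win_event B P (Suc n) (opponent P)) =
    pgf p (measure (GW p) (win_event B P n P)) - (if opponent P \<in> B then 0 else pmf p 0)"
proof -
  interpret prob_space "GW p" by (rule prob_space_GW)
  let ?E = "{\<omega>. \<forall>i<\<omega> []. subtree i \<omega> \<in> win_event B P n P}"
  show ?thesis
  proof (cases "opponent P \<in> B")
    case False
    have "prob (?E - {\<omega>. \<omega> [] = 0}) = prob ?E - prob {\<omega>. \<omega> [] = 0}"
      by (intro finite_measure_Diff sets_GW_all_subtrees sets_win_event sets_GW_root) auto
    with False show ?thesis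
      by (simp add: win_event_Suc_opponent prob_all_subtrees sets_win_event prob_root)
  qed (simp add: win_event_Suc_opponent prob_all_subtrees sets_win_event)
qed

section \<open>Win probabilities as least solutions\<close>

definition win_prob :: "nat pmf \<Rightarrow> player set \<Rightarrow> player \<Rightarrow> player \<Rightarrow> real" where
  "win_prob p B P Q = measure (GW p) (\<Union>n. win_event B P n Q)"

lemma tendsto_win_prob:
  "(\<lambda>n. measure (GW p) (win_event B P n Q)) \<longlonglongrightarrow> win_prob p B P Q"
proof -
  interpret prob_space "GW p" by (rule prob_space_GW)
  show ?thesis
    unfolding win_prob_def
    by (intro finite_Lim_measure_incseq incseq_win_event) (auto intro: sets_win_event)
qed

lemma prob_GW_bounds: "0 \<le> measure (GW p) A" "measure (GW p) A \<le> 1"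
  by (simp_all add: prob_space.prob_le_1[OF prob_space_GW])

lemma win_prob_bounds: "0 \<le> win_prob p B P Q" "win_prob p B P Q \<le> 1"
  by (simp_all add: win_prob_def prob_GW_bounds)

lemma tendsto_pgf:
  assumes "X \<longlonglongrightarrow> l" "\<And>n. 0 \<le> X n" "\<And>n. X n \<le> 1"
  shows "(\<lambda>n. pgf p (X n)) \<longlonglongrightarrow> pgf p l"
proof -
  have "l \<in> {0..1}"
    using assms LIMSEQ_le_const[of X l 0] LIMSEQ_le_const2[of X l 1] by auto
  then show ?thesis
    using assms by (intro continuous_on_tendsto_compose[OF continuous_on_pgf assms(1)]) auto
qed

lemma win_prob_self:
  "win_prob p B P P = 1 - pgf p (1 - win_prob p B P (opponent P)) + (if P \<in> B then pmf p 0 else 0)"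
proof (rule LIMSEQ_unique)
  show "(\<lambda>n. measure (GW p) (win_event B P (Suc n) P)) \<longlonglongrightarrow> win_prob p B P P"
    by (rule LIMSEQ_Suc[OF tendsto_win_prob])
  show "(\<lambda>n. measure (GW p) (win_event B P (Suc n) P)) \<longlonglongrightarrow>
      1 - pgf p (1 - win_prob p B P (opponent P)) + (if P \<in> B then pmf p 0 else 0)"
    unfolding prob_win_event_Suc_self
    by (intro tendsto_intros tendsto_pgf tendsto_win_prob) (auto simp: prob_GW_bounds)
qed

lemma win_prob_opponent:
  "win_prob p B P (opponent P) = pgf p (win_prob p B P P) - (if opponent P \<in> B then 0 else pmf p 0)"
proof (rule LIMSEQ_unique)
  show "(\<lambda>n. measure (GW p) (win_event B P (Suc n) (opponent P))) \<longlonglongrightarrow> win_prob p B P (opponent P)"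
    by (rule LIMSEQ_Suc[OF tendsto_win_prob])
  show "(\<lambda>n. measure (GW p) (win_event B P (Suc n) (opponent P))) \<longlonglongrightarrow>
      pgf p (win_prob p B P P) - (if opponent P \<in> B then 0 else pmf p 0)"
    unfolding prob_win_event_Suc_opponent
    by (intro tendsto_intros tendsto_pgf tendsto_win_prob) (auto simp: prob_GW_bounds)
qed

text \<open>The recursion is monotone and starts at \<open>(0, 0)\<close>, so no iterate can pass a
  point \<open>(x, y)\<close> that the recursion does not increase; the limits inherit the
  bound.\<close>

lemma win_prob_least:
  assumes x: "0 \<le> x" "x \<le> 1" and y: "0 \<le> y" "y \<le> 1"
    and le_x: "1 - pgf p (1 - y) + (if P \<in> B then pmf p 0 else 0) \<le> x"
    and le_y: "pgf p x - (if opponent P \<in> B then 0 else pmf p 0) \<le> y"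
  shows "win_prob p B P P \<le> x" "win_prob p B P (opponent P) \<le> y"
proof -
  have le: "measure (GW p) (win_event B P n P) \<le> x \<and> measure (GW p) (win_event B P n (opponent P)) \<le> y" for n
  proof (induction n)
    case (Suc n)
    then have "pgf p (1 - y) \<le> pgf p (1 - measure (GW p) (win_event B P n (opponent P)))"
      "pgf p (measure (GW p) (win_event B P n P)) \<le> pgf p x"
      using x y by (auto intro!: pgf_mono simp: prob_GW_bounds)
    with le_x le_y show ?case
      by (simp only: prob_win_event_Suc_self prob_win_event_Suc_opponent) simp
  qed (use x y in \<open>simp add: win_event_0\<close>)
  show "win_prob p B P P \<le> x" "win_prob p B P (opponent P) \<le> y"
    using le by (auto intro: LIMSEQ_le_const2[OF tendsto_win_prob])
qed

lemma win_prob_swap: "win_prob p (opponent ` B) (opponent P) (opponent Q) = win_prob p B P Q"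
  by (simp add: win_prob_def win_event_opponent)

text \<open>The two win events are disjoint, and renaming the players in Second's event expresses
  everything by wins of First, with First or Second to move.\<close>

lemma prob_no_winning_strategy:
  assumes disj: "\<And>\<omega> \<sigma> \<tau>. \<not> (winning_strategy (children \<omega>) [] First B \<sigma> \<and>
      winning_strategy (children \<omega>) [] Second (opponent ` B) \<tau>)"
  shows "measure (GW p) {\<omega>. (\<nexists>\<sigma>. winning_strategy (children \<omega>) [] First B \<sigma>) \<and>
      (\<nexists>\<sigma>. winning_strategy (children \<omega>) [] Second (opponent ` B) \<sigma>)} =
    1 - win_prob p B First First - win_prob p B First Second"
proof -
  interpret prob_space "GW p" by (rule prob_space_GW)
  let ?U = "\<Union>n. win_event B First n First" and ?V = "\<Union>n. win_event (opponent ` B) Second n First"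
  have sets: "?U \<in> sets (GW p)" "?V \<in> sets (GW p)"
    by (auto intro: sets_win_event)
  have "?U \<inter> ?V = {}"
  proof (rule equals0I)
    fix \<omega> assume "\<omega> \<in> ?U \<inter> ?V"
    with disj[of \<omega>] show False
      by (simp only: Int_iff ex_winning_strategy_iff[symmetric]) blast
  qed
  then have "prob (?U \<union> ?V) = win_prob p B First First + win_prob p (opponent ` B) Second First"
    unfolding win_prob_def using sets by (intro finite_measure_Union) auto
  also have "win_prob p (opponent ` B) Second First = win_prob p B First Second"
    using win_prob_swap[of p B First Second] by simp
  finally have UV: "prob (?U \<union> ?V) = win_prob p B First First + win_prob p B First Second" .
  have "{\<omega>. (\<nexists>\<sigma>. winning_strategy (children \<omega>) [] First B \<sigma>) \<and>
      (\<nexists>\<sigma>. winning_strategy (children \<omega>) [] Second (opponent ` B) \<sigma>)} =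
      space (GW p) - (?U \<union> ?V)"
    by (auto simp only: ex_winning_strategy_iff space_GW)
  also have "prob \<dots> = 1 - prob (?U \<union> ?V)"
    using sets by (intro prob_compl sets.Un)
  finally show ?thesis by (simp only: UV diff_diff_add)
qed

section \<open>Fixed point equations\<close>

definition two_cycle :: "(real \<Rightarrow> real) \<Rightarrow> real \<Rightarrow> real \<Rightarrow> bool" where
  "two_cycle F x y \<longleftrightarrow> 0 \<le> x \<and> x \<le> y \<and> y \<le> 1 \<and> F x = y \<and> F y = x"

definition max_cycle_width :: "(real \<Rightarrow> real) \<Rightarrow> real \<Rightarrow> bool" where
  "max_cycle_width F d \<longleftrightarrow>
     (\<exists>x y. two_cycle F x y \<and> d = y - x) \<and> (\<forall>x y. two_cycle F x y \<longrightarrow> y - x \<le> d)"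

lemma max_cycle_width_nonneg: "max_cycle_width F d \<Longrightarrow> 0 \<le> d"
  by (auto simp: max_cycle_width_def two_cycle_def)

lemma two_cycle_le: "two_cycle F x y \<Longrightarrow> x \<le> y"
  by (simp add: two_cycle_def)

lemma max_cycle_width_eq_0:
  assumes "max_cycle_width F d" "\<And>x y. two_cycle F x y \<Longrightarrow> x = y"
  shows "d = 0"
  using assms unfolding max_cycle_width_def by force

lemma max_cycle_width_pos_iff:
  assumes "max_cycle_width F d"
  shows "d > 0 \<longleftrightarrow> (\<exists>x y. two_cycle F x y \<and> x < y)"
proof
  assume "d > 0"
  with assms show "\<exists>x y. two_cycle F x y \<and> x < y"
    unfolding max_cycle_width_def by force
next
  assume "\<exists>x y. two_cycle F x y \<and> x < y"
  then obtain x y where "two_cycle F x y" "x < y" by blast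
  with assms have "y - x \<le> d" by (simp add: max_cycle_width_def)
  with \<open>x < y\<close> show "d > 0" by simp
qed

text \<open>With \<open>a\<close> and \<open>b\<close> the win probabilities of First when First or
  Second moves, the equations read \<open>a = F (1 - b)\<close> and \<open>1 - b = F a\<close>, so
  \<open>(a, 1 - b)\<close> is a cycle. Any cycle \<open>(x, y)\<close> yields the solution
  \<open>(x, 1 - y)\<close>; since \<open>a\<close> and \<open>b\<close> are both least, none is
  wider. Exactly one player lies in \<open>B\<close>, which makes the correction \<open>c\<close>
  the same in both equations.\<close>

lemma max_cycle_width_win_prob:
  fixes p B
  defines "c \<equiv> (if First \<in> B then pmf p 0 else 0)"
  assumes B: "First \<in> B \<longleftrightarrow> Second \<notin> B"
    and le: "win_prob p B First First + win_prob p B First Second \<le> 1"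
  shows "max_cycle_width (\<lambda>x. 1 - pgf p x + c) (1 - win_prob p B First First - win_prob p B First Second)"
proof -
  have opp: "opponent First = Second" by simp
  have c: "(if Second \<in> B then 0 else pmf p 0) = c"
    using B by (simp add: c_def)
  let ?a = "win_prob p B First First" and ?b = "win_prob p B First Second"
  have "?a = 1 - pgf p (1 - ?b) + c" "?b = pgf p ?a - c"
    using win_prob_self[of p B First] win_prob_opponent[of p B First] c by (simp_all add: c_def)
  then have "two_cycle (\<lambda>x. 1 - pgf p x + c) ?a (1 - ?b)"
    using win_prob_bounds[of p B First First] win_prob_bounds[of p B First Second] le
    by (simp add: two_cycle_def)
  moreover have "y - x \<le> 1 - ?a - ?b" if "two_cycle (\<lambda>x. 1 - pgf p x + c) x y" for x y
    using win_prob_least[of x "1 - y" p First B] that c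
    by (simp add: two_cycle_def c_def)
  ultimately show ?thesis
    unfolding max_cycle_width_def by (intro conjI exI[of _ ?a] exI[of _ "1 - ?b"]) auto
qed

text \<open>\<open>Q\<close> is the player whose being stuck makes First win: Second in the normal
  game, First in the misere game. One statement thus serves both.\<close>

lemma max_cycle_width_no_winning_strategy:
  "max_cycle_width (\<lambda>x. 1 - pgf p x + (if First = Q then pmf p 0 else 0))
    (measure (GW p) {\<omega>. (\<nexists>\<sigma>. winning_strategy (children \<omega>) [] First {Q} \<sigma>) \<and>
      (\<nexists>\<sigma>. winning_strategy (children \<omega>) [] Second {opponent Q} \<sigma>)})"
proof -
  have *: "measure (GW p) {\<omega>. (\<nexists>\<sigma>. winning_strategy (children \<omega>) [] First {Q} \<sigma>) \<and>
      (\<nexists>\<sigma>. winning_strategy (children \<omega>) [] Second {opponent Q} \<sigma>)} =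
      1 - win_prob p {Q} First First - win_prob p {Q} First Second"
  proof -
    have img: "opponent ` {Q} = {opponent Q}" by simp
    show ?thesis
      by (rule prob_no_winning_strategy[of "{Q}" p, unfolded img])
        (auto dest: not_both_winning_strategy)
  qed
  moreover have "win_prob p {Q} First First + win_prob p {Q} First Second \<le> 1"
    using prob_GW_bounds(1)[of p "{\<omega>. (\<nexists>\<sigma>. winning_strategy (children \<omega>) [] First {Q} \<sigma>) \<and>
      (\<nexists>\<sigma>. winning_strategy (children \<omega>) [] Second {opponent Q} \<sigma>)}"]
    unfolding * by linarith
  moreover have "First \<in> {Q} \<longleftrightarrow> Second \<notin> {Q}"
    by (cases Q) auto
  ultimately show ?thesis
    using max_cycle_width_win_prob[of "{Q}" p] by simp
qed

lemma all_player_iff: "(\<forall>P. R P) \<longleftrightarrow> R First \<and> R Second"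
proof (intro iffI allI)
  fix P assume "R First \<and> R Second"
  then show "R P" by (cases P) auto
qed auto

lemma max_cycle_width_D_normal: "max_cycle_width (\<lambda>x. 1 - pgf p x) (D_normal p)"
  using max_cycle_width_no_winning_strategy[of p Second]
  by (simp add: D_normal_def normal_draw_def all_player_iff)

lemma max_cycle_width_D_misere: "max_cycle_width (\<lambda>x. 1 - pgf p x + pmf p 0) (D_misere p)"
  using max_cycle_width_no_winning_strategy[of p First]
  by (simp add: D_misere_def misere_draw_def all_player_iff)

text \<open>After renaming, Stopper is always First. Hence Escaper moving first corresponds to
  Second being the mover at the root.\<close>

lemma E_eq_win_prob:
  "E1 p = 1 - win_prob p UNIV First Second" "E2 p = 1 - win_prob p UNIV First First"
proof -
  interpret prob_space "GW p" by (rule prob_space_GW)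
  have *: "prob {\<omega>. escaper_wins (children \<omega>) [] P} = 1 - win_prob p UNIV (opponent P) First" for P
  proof -
    let ?U = "\<Union>n. win_event UNIV (opponent P) n First"
    have "{\<omega>. escaper_wins (children \<omega>) [] P} = space (GW p) - ?U"
      by (auto simp: escaper_wins_def ex_winning_strategy_iff simp del: UN_iff)
    moreover have "?U \<in> sets (GW p)"
      by (auto intro: sets_win_event)
    ultimately show ?thesis
      unfolding win_prob_def by (simp only: prob_compl)
  qed
  have "win_prob p UNIV Second First = win_prob p UNIV First Second"
  proof -
    have "opponent ` UNIV = UNIV"
      by (rule surjI[of _ opponent]) simp
    with win_prob_swap[of p UNIV First Second] show ?thesis by simp
  qed
  with *[of First] *[of Second] show "E1 p = 1 - win_prob p UNIV First Second"
    "E2 p = 1 - win_prob p UNIV First First"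
    by (simp_all add: E1_def E2_def)
qed

lemma E_bounds: "0 \<le> E1 p" "E1 p \<le> 1" "0 \<le> E2 p" "E2 p \<le> 1"
  by (simp_all add: E_eq_win_prob win_prob_bounds)

lemma E1_eq: "E1 p = 1 - pgf p (1 - E2 p)"
  using win_prob_opponent[of p UNIV First] by (simp add: E_eq_win_prob)

lemma E2_eq: "E2 p = pgf p (E1 p) - pmf p 0"
  using win_prob_self[of p UNIV First] by (simp add: E_eq_win_prob)

text \<open>Leastness of Stopper's win probabilities, read through complements. Lower bounds on the
  escape probabilities will come from explicit subsolutions \<open>u\<close>,
  \<open>v\<close>.\<close>

lemma E_greatest:
  assumes "0 \<le> u" "u \<le> 1" "0 \<le> v" "v \<le> 1" "v \<le> 1 - pgf p (1 - u)" "u \<le> pgf p v - pmf p 0"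
  shows "v \<le> E1 p" "u \<le> E2 p"
  using win_prob_least[of "1 - u" "1 - v" p First UNIV] assms by (simp_all add: E_eq_win_prob)

text \<open>The parameters admitting a 2-cycle of width at least \<open>e\<close> are the projection of a compact
  set, so they stay away from a parameter \<open>c\<close> that admits none.\<close>

lemma max_cycle_width_tendsto_0:
  fixes F :: "real \<Rightarrow> real \<Rightarrow> real"
  assumes cd: "c < d"
    and cont: "continuous_on ({c..d} \<times> {0..1}) (\<lambda>z. F (fst z) (snd z))"
    and no_cycle: "\<And>x y. two_cycle (F c) x y \<Longrightarrow> x = y"
    and width: "\<And>l. c < l \<Longrightarrow> l < d \<Longrightarrow> max_cycle_width (F l) (D l)"
  shows "(D \<longlongrightarrow> 0) (at_right c)"
proof (rule order_tendstoI)
  fix e :: real assume "e > 0"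
  define S where "S = {z \<in> {c..d} \<times> {0..1} \<times> {0..1}.
    F (fst z) (snd (snd z)) - fst (snd z) \<in> {0} \<and> F (fst z) (fst (snd z)) - snd (snd z) \<in> {0} \<and>
    snd (snd z) - fst (snd z) \<in> {e..}}"
  have K: "closed ({c..d} \<times> {0..1::real} \<times> {0..1::real})"
    by (intro closed_Times) auto
  have c1: "continuous_on ({c..d} \<times> {0..1} \<times> {0..1}) (\<lambda>z. F (fst z) (snd (snd z)) - fst (snd z))"
    by (intro continuous_intros continuous_on_compose2[OF cont, of _ "\<lambda>z. (fst z, snd (snd z))", simplified]) auto
  have c2: "continuous_on ({c..d} \<times> {0..1} \<times> {0..1}) (\<lambda>z. F (fst z) (fst (snd z)) - snd (snd z))"
    by (intro continuous_intros continuous_on_compose2[OF cont, of _ "\<lambda>z. (fst z, fst (snd z))", simplified]) auto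
  have c3: "continuous_on ({c..d} \<times> {0..1::real} \<times> {0..1::real}) (\<lambda>z. snd (snd z) - fst (snd z))"
    by (intro continuous_intros)
  have "S = ({c..d} \<times> {0..1} \<times> {0..1} \<inter> (\<lambda>z. F (fst z) (snd (snd z)) - fst (snd z)) -` {0}) \<inter>
      ({c..d} \<times> {0..1} \<times> {0..1} \<inter> (\<lambda>z. F (fst z) (fst (snd z)) - snd (snd z)) -` {0}) \<inter>
      ({c..d} \<times> {0..1} \<times> {0..1} \<inter> (\<lambda>z. snd (snd z) - fst (snd z)) -` {e..})"
    unfolding S_def by blast
  moreover have "closed \<dots>"
    by (intro closed_Int continuous_closed_preimage[OF c1 K] continuous_closed_preimage[OF c2 K]
        continuous_closed_preimage[OF c3 K]) auto
  moreover have "S \<subseteq> {c..d} \<times> {0..1} \<times> {0..1}"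
    by (auto simp: S_def)
  moreover have "compact ({c..d} \<times> {0..1::real} \<times> {0..1::real})"
    by (intro compact_Times) auto
  ultimately have "compact S"
    by (metis compact_Int_closed inf.absorb_iff2)
  then have "closed (fst ` S)"
    by (intro compact_imp_closed compact_continuous_image continuous_intros)
  moreover have "c \<notin> fst ` S"
  proof
    assume "c \<in> fst ` S"
    then obtain x y where "(c, x, y) \<in> S" by force
    then have "two_cycle (F c) x y" "e \<le> y - x"
      using \<open>e > 0\<close> by (auto simp: S_def two_cycle_def)
    with no_cycle \<open>e > 0\<close> show False by fastforce
  qed
  ultimately have "open (- fst ` S)" "c \<in> - fst ` S"
    by auto
  then have "\<forall>\<^sub>F l in at_right c. l \<in> - fst ` S"
    by (rule topological_tendstoD[OF tendsto_ident_at])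
  moreover have "\<forall>\<^sub>F l in at_right c. l \<in> {c<..<d}"
    by (rule eventually_at_right_real[OF cd])
  ultimately show "\<forall>\<^sub>F l in at_right c. D l < e"
  proof eventually_elim
    case (elim l)
    then obtain x y where xy: "two_cycle (F l) x y" "D l = y - x"
      using width[of l] by (auto simp: max_cycle_width_def)
    show ?case
    proof (rule ccontr)
      assume "\<not> D l < e"
      with xy elim(2) have "(l, x, y) \<in> S"
        by (auto simp: S_def two_cycle_def)
      with elim(1) show False by force
    qed
  qed
next
  fix e :: real assume "e < 0"
  have "\<forall>\<^sub>F l in at_right c. l \<in> {c<..<d}"
    by (rule eventually_at_right_real[OF cd])
  then show "\<forall>\<^sub>F l in at_right c. e < D l"
  proof eventually_elim
    case (elim l)
    with width[of l] max_cycle_width_nonneg[of "F l" "D l"] \<open>e < 0\<close> show ?case by simp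
  qed
qed

lemma not_isCont_jump:
  fixes f :: "real \<Rightarrow> real"
  assumes "f c > 0" "b < c" "\<And>x. b < x \<Longrightarrow> x < c \<Longrightarrow> f x = 0"
  shows "\<not> isCont f c"
proof
  assume "isCont f c"
  then have "(f \<longlongrightarrow> f c) (at_left c)"
    by (simp add: isCont_def filterlim_at_split)
  moreover have "\<forall>\<^sub>F x in at_left c. f x = 0"
    using eventually_at_left_real[OF assms(2)] by eventually_elim (use assms(3) in auto)
  then have "(f \<longlongrightarrow> 0) (at_left c)"
    by (simp add: tendsto_cong)
  ultimately have "f c = 0"
    using tendsto_unique trivial_limit_at_left_real by blast
  with assms(1) show False by simp
qed

section \<open>Binary and geometric offspring\<close>

lemma pgf_binary:
  assumes "0 \<le> t" "t \<le> 1"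
  shows "pgf (binary_pmf t) x = 1 - t + t * x\<^sup>2"
proof -
  have "pgf (binary_pmf t) x = (\<Sum>k\<in>{0, 2}. pmf (binary_pmf t) k * x ^ k)"
    unfolding pgf_def using assms by (intro suminf_finite) (auto simp: pmf_binary_pmf)
  then show ?thesis
    using assms by (simp add: pmf_binary_pmf)
qed

text \<open>Subtracting the equations of a proper cycle leaves \<open>t * (x + y) = 1\<close>, and
  then \<open>(t * (y - x))^2 = 4 * c * t - 3\<close>. The normal game has \<open>c = t\<close>, the
  misere game \<open>c = 1\<close>.\<close>

lemma quadratic_two_cycle_iff:
  assumes t: "0 \<le> t" "t \<le> c" "c \<le> 1"
  shows "(\<exists>x y. two_cycle (\<lambda>x. c - t * x\<^sup>2) x y \<and> x < y) \<longleftrightarrow> 4 * c * t > 3"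
proof
  assume "\<exists>x y. two_cycle (\<lambda>x. c - t * x\<^sup>2) x y \<and> x < y"
  then obtain x y where xy: "c - t * x\<^sup>2 = y" "c - t * y\<^sup>2 = x" "x < y"
    by (auto simp: two_cycle_def)
  have "t * y\<^sup>2 - t * x\<^sup>2 = y - x"
    using xy(1,2) by linarith
  then have "(y - x) * (t * (x + y)) = (y - x) * 1"
    by (simp add: algebra_simps power2_eq_square)
  with xy(3) have s: "t * (x + y) = 1" by simp
  have "(t * (y - x))\<^sup>2 = 4 * c * t - 3"
    using s xy(1,2) by algebra
  moreover have "t * (y - x) \<noteq> 0"
    using s xy(3) by auto
  ultimately show "4 * c * t > 3"
    using zero_less_power2[of "t * (y - x)"] by simp
next
  assume ct: "4 * c * t > 3"
  then have "t > 0"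
    using t by (cases "t = 0") auto
  define r where "r = sqrt (4 * c * t - 3)"
  have r2: "r * r = 4 * c * t - 3" and "r > 0"
    using ct by (simp_all add: r_def)
  have "c * t \<le> 1 * 1"
    using t by (intro mult_mono) auto
  then have "r \<le> 1"
    using real_sqrt_le_mono[of "4 * c * t - 3" 1] by (simp add: r_def)
  have c: "c = (r * r + 3) / (4 * t)"
    using r2 \<open>t > 0\<close> by (simp add: field_simps)
  \<comment> \<open>The pair with sum \<open>1 / t\<close> and difference \<open>r / t\<close>;
    \<open>r \<le> 1\<close> makes the smaller one nonnegative.\<close>
  let ?x = "(1 - r) / (2 * t)" and ?y = "(1 + r) / (2 * t)"
  have x: "c - t * ?x\<^sup>2 = ?y"
    unfolding c using \<open>t > 0\<close> by (simp add: field_simps power2_eq_square)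
  have y: "c - t * ?y\<^sup>2 = ?x"
    unfolding c using \<open>t > 0\<close> by (simp add: field_simps power2_eq_square)
  have "?y \<le> 1"
    unfolding x[symmetric] using t mult_nonneg_nonneg[OF t(1) zero_le_power2[of ?x]] by linarith
  moreover have "0 \<le> ?x" "?x < ?y"
    using \<open>r \<le> 1\<close> \<open>r > 0\<close> \<open>t > 0\<close> by (auto simp: divide_strict_right_mono)
  ultimately show "\<exists>x y. two_cycle (\<lambda>x. c - t * x\<^sup>2) x y \<and> x < y"
    unfolding two_cycle_def using x y by (intro exI[of _ ?x] exI[of _ ?y]) auto
qed

lemma max_cycle_width_binary:
  assumes "0 \<le> t" "t \<le> 1"
  shows "max_cycle_width (\<lambda>x. t - t * x\<^sup>2) (D_normal (binary_pmf t))"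
    and "max_cycle_width (\<lambda>x. 1 - t * x\<^sup>2) (D_misere (binary_pmf t))"
  using max_cycle_width_D_normal[of "binary_pmf t"] max_cycle_width_D_misere[of "binary_pmf t"] assms
  by (simp_all add: pgf_binary pmf_binary_pmf)

lemma D_normal_binary_pos_iff:
  assumes "0 \<le> t" "t \<le> 1"
  shows "D_normal (binary_pmf t) > 0 \<longleftrightarrow> t > sqrt 3 / 2"
proof -
  have "D_normal (binary_pmf t) > 0 \<longleftrightarrow> 4 * t * t > 3"
    using max_cycle_width_pos_iff[OF max_cycle_width_binary(1)[OF assms]]
      quadratic_two_cycle_iff[of t t] assms by simp
  also have "\<dots> \<longleftrightarrow> sqrt 3 < sqrt ((2 * t)\<^sup>2)"
    by (simp add: power2_eq_square mult.assoc)
  also have "\<dots> \<longleftrightarrow> t > sqrt 3 / 2"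
    using assms by (subst real_sqrt_unique[of "2 * t"]) auto
  finally show ?thesis .
qed

lemma D_misere_binary_pos_iff:
  assumes "0 \<le> t" "t \<le> 1"
  shows "D_misere (binary_pmf t) > 0 \<longleftrightarrow> t > 3 / 4"
  using max_cycle_width_pos_iff[OF max_cycle_width_binary(2)[OF assms]]
    quadratic_two_cycle_iff[of t 1] assms by auto

lemma D_normal_binary_tendsto:
  "((\<lambda>t. D_normal (binary_pmf t)) \<longlongrightarrow> 0) (at_right (sqrt 3 / 2))"
proof (rule max_cycle_width_tendsto_0[of _ 1 "\<lambda>t x. t - t * x\<^sup>2"])
  show c: "sqrt 3 / 2 < 1"
    using real_sqrt_less_mono[of 3 4] by simp
  show "x = y" if "two_cycle (\<lambda>x. sqrt 3 / 2 - sqrt 3 / 2 * x\<^sup>2) x y" for x y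
    using quadratic_two_cycle_iff[of "sqrt 3 / 2" "sqrt 3 / 2"] that two_cycle_le[OF that] c
    by (auto simp: order_le_less)
  show "max_cycle_width (\<lambda>x. t - t * x\<^sup>2) (D_normal (binary_pmf t))"
    if "sqrt 3 / 2 < t" "t < 1" for t
    by (rule max_cycle_width_binary(1)) (use that real_sqrt_ge_zero[of 3] in linarith)+
qed (intro continuous_intros)

lemma D_misere_binary_tendsto:
  "((\<lambda>t. D_misere (binary_pmf t)) \<longlongrightarrow> 0) (at_right (3 / 4))"
proof (rule max_cycle_width_tendsto_0[of _ 1 "\<lambda>t x. 1 - t * x\<^sup>2"])
  show "x = y" if "two_cycle (\<lambda>x. 1 - 3 / 4 * x\<^sup>2) x y" for x y
    using quadratic_two_cycle_iff[of "3 / 4" 1] that two_cycle_le[OF that]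
    by (auto simp: order_le_less)
  show "max_cycle_width (\<lambda>x. 1 - t * x\<^sup>2) (D_misere (binary_pmf t))"
    if "3 / 4 < t" "t < 1" for t
    by (rule max_cycle_width_binary(2)) (use that in auto)
qed (auto intro!: continuous_intros)

section \<open>The escape game with binary offspring\<close>

lemma E_binary_eq:
  assumes "0 \<le> t" "t \<le> 1"
  shows "E1 (binary_pmf t) = t * (2 * E2 (binary_pmf t) - (E2 (binary_pmf t))\<^sup>2)"
    and "E2 (binary_pmf t) = t * (E1 (binary_pmf t))\<^sup>2"
  using E1_eq[of "binary_pmf t"] E2_eq[of "binary_pmf t"] assms
  by (simp_all add: pgf_binary pmf_binary_pmf algebra_simps power2_eq_square)

lemma E_binary_pos_iff:
  assumes "0 \<le> t" "t \<le> 1"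
  shows "E1 (binary_pmf t) > 0 \<longleftrightarrow> E2 (binary_pmf t) > 0"
proof
  assume "E1 (binary_pmf t) > 0"
  then have "E2 (binary_pmf t) \<noteq> 0"
    using E_binary_eq(1)[OF assms] by auto
  then show "E2 (binary_pmf t) > 0"
    using E_bounds(3)[of "binary_pmf t"] by simp
next
  assume "E2 (binary_pmf t) > 0"
  then have "E1 (binary_pmf t) \<noteq> 0"
    using E_binary_eq(2)[OF assms] by auto
  then show "E1 (binary_pmf t) > 0"
    using E_bounds(1)[of "binary_pmf t"] by simp
qed

text \<open>Writing \<open>q\<close> for the cube root of 2, the critical parameter is \<open>3 * q / 4\<close>, and
  \<open>w = q * t * E1\<close> satisfies \<open>w * (4 * t / q) = w ^ 3 + 2\<close>, while
  \<open>w ^ 3 - 3 * w + 2 = (w - 1)\<^sup>2 * (w + 2)\<close> makes \<open>w = 1\<close> a double root at criticality.\<close>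

lemma E_binary_cubic:
  assumes t: "0 \<le> t" "t \<le> 1" and q: "q ^ 3 = (2::real)" "0 < q"
    and pos: "E1 (binary_pmf t) > 0"
  defines "w \<equiv> q * t * E1 (binary_pmf t)"
  shows "w > 0" "w * (4 * t / q - 3) = (w - 1)\<^sup>2 * (w + 2)"
proof -
  define v where "v = E1 (binary_pmf t)"
  have v: "v = t * (2 * (t * v\<^sup>2) - (t * v\<^sup>2)\<^sup>2)" "v > 0"
    using E_binary_eq[OF t] pos by (simp_all add: v_def)
  then have "t \<noteq> 0" by auto
  with t v(2) q(2) show "w > 0"
    by (simp add: w_def v_def)
  have "v * (2 * t * t * v - t ^ 3 * v ^ 3) = v * 1"
    using v(1) by (simp add: algebra_simps power2_eq_square power3_eq_cube)
  with v(2) have s: "2 * t * t * v - t ^ 3 * v ^ 3 = 1" by simp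
  have "w * (4 * t / q) = 2 * (2 * t * t * v)"
    using q(2) by (simp add: w_def v_def)
  also have "\<dots> = 2 + w ^ 3"
    using s q(1) by (simp add: w_def v_def power_mult_distrib)
  finally show "w * (4 * t / q - 3) = (w - 1)\<^sup>2 * (w + 2)"
    by (simp add: algebra_simps power2_eq_square power3_eq_cube)
qed

text \<open>The bounds are the exact values at criticality, where \<open>w = 1\<close>. The
  right-hand sides of the equations grow with \<open>t\<close>, so these values remain a subsolution
  for every larger \<open>t\<close>.\<close>

lemma E_binary_ge:
  assumes q: "q ^ 3 = (2::real)" "0 < q" and t: "3 * q / 4 \<le> t" "t \<le> 1"
  shows "2 * q / 3 \<le> E1 (binary_pmf t)" "2 / 3 \<le> E2 (binary_pmf t)"
proof -
  have t0: "0 \<le> t" using q t by linarith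
  \<comment> \<open>Keeps the candidate \<open>2 * q / 3\<close> for \<open>E1\<close> inside the
    unit interval.\<close>
  have "q \<le> 3 / 2"
  proof (rule ccontr)
    assume "\<not> q \<le> 3 / 2"
    then have "(3 / 2) ^ 3 \<le> q ^ 3" by (intro power_mono) auto
    with q(1) show False by (simp add: power3_eq_cube)
  qed
  moreover have "2 / 3 = 3 * q / 4 * (2 * q / 3)\<^sup>2"
    using q(1) by (simp add: power2_eq_square power3_eq_cube)
  then have "2 / 3 \<le> t * (2 * q / 3)\<^sup>2"
    using t by (metis mult_right_mono zero_le_power2)
  ultimately have "2 * q / 3 \<le> E1 (binary_pmf t) \<and> 2 / 3 \<le> E2 (binary_pmf t)"
    using q(2) t t0
    by (intro conjI E_greatest[of "2 / 3" "2 * q / 3"])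
      (auto simp: pgf_binary pmf_binary_pmf power2_eq_square)
  then show "2 * q / 3 \<le> E1 (binary_pmf t)" "2 / 3 \<le> E2 (binary_pmf t)" by auto
qed

lemma E1_binary_pos_iff:
  assumes q: "q ^ 3 = (2::real)" "0 < q" and t: "0 \<le> t" "t \<le> 1"
  shows "E1 (binary_pmf t) > 0 \<longleftrightarrow> 3 * q / 4 \<le> t"
proof
  assume "E1 (binary_pmf t) > 0"
  note w = E_binary_cubic[OF t q this]
  let ?w = "q * t * E1 (binary_pmf t)"
  have "?w * (4 * t / q - 3) \<ge> ?w * 0"
    using w by simp
  with w(1) have "4 * t / q - 3 \<ge> 0"
    using mult_le_cancel_left_pos[of ?w 0 "4 * t / q - 3"] by blast
  with q(2) show "3 * q / 4 \<le> t" by (simp add: field_simps)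
next
  assume "3 * q / 4 \<le> t"
  from E_binary_ge(1)[OF q this t(2)] q(2) show "E1 (binary_pmf t) > 0" by linarith
qed

lemma E1_binary_critical:
  assumes q: "q ^ 3 = (2::real)" "0 < q" and t: "3 * q / 4 \<le> 1"
  shows "E1 (binary_pmf (3 * q / 4)) = 2 * q / 3"
proof -
  have t0: "0 \<le> 3 * q / 4" using q by simp
  have "E1 (binary_pmf (3 * q / 4)) > 0"
    using E1_binary_pos_iff[OF q t0 t] by simp
  \<comment> \<open>At this parameter \<open>4 * t / q = 3\<close>, so the left-hand side of the
    cubic vanishes and the double root \<open>w = 1\<close> is forced.\<close>
  from E_binary_cubic[OF t0 t q this] q(2)
  have "q * (3 * q / 4) * E1 (binary_pmf (3 * q / 4)) = 1"
    by simp
  then have "q ^ 3 * 3 * E1 (binary_pmf (3 * q / 4)) = 4 * q"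
    by (simp add: power3_eq_cube field_simps)
  with q(1) show ?thesis by simp
qed

lemma E_binary_jump:
  assumes q: "q ^ 3 = (2::real)" "0 < q" and t: "3 * q / 4 \<le> 1"
  shows "\<not> isCont (\<lambda>t. E1 (binary_pmf t)) (3 * q / 4)"
    and "\<not> isCont (\<lambda>t. E2 (binary_pmf t)) (3 * q / 4)"
proof -
  have 0: "E1 (binary_pmf x) = 0" "E2 (binary_pmf x) = 0" if "0 < x" "x < 3 * q / 4" for x
    using that t E1_binary_pos_iff[OF q, of x] E_binary_pos_iff[of x] E_bounds[of "binary_pmf x"] by auto
  have "E1 (binary_pmf (3 * q / 4)) > 0" "E2 (binary_pmf (3 * q / 4)) > 0"
    using E1_binary_pos_iff[OF q, of "3 * q / 4"] E_binary_pos_iff[of "3 * q / 4"] q t by auto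
  then show "\<not> isCont (\<lambda>t. E1 (binary_pmf t)) (3 * q / 4)"
    "\<not> isCont (\<lambda>t. E2 (binary_pmf t)) (3 * q / 4)"
    using not_isCont_jump[of "\<lambda>t. E1 (binary_pmf t)" "3 * q / 4" 0]
      not_isCont_jump[of "\<lambda>t. E2 (binary_pmf t)" "3 * q / 4" 0] 0 q(2)
    by simp_all
qed

section \<open>Geometric offspring\<close>

lemma pgf_geometric:
  assumes a: "0 < a" "a < 1" and x: "0 \<le> x" "x \<le> 1"
  shows "pgf (geometric_pmf (1 - a)) x = (1 - a) / (1 - a * x)"
proof -
  have "a * x < 1"
    using a x mult_left_le[of x a] by linarith
  then have "(\<lambda>k. (1 - a) * (a * x) ^ k) sums ((1 - a) * (1 / (1 - a * x)))"
    using a x by (intro sums_mult geometric_sums) auto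
  moreover have "pmf (geometric_pmf (1 - a)) k * x ^ k = (1 - a) * (a * x) ^ k" for k
    using a by (simp add: power_mult_distrib)
  ultimately show ?thesis
    by (simp add: pgf_def sums_iff)
qed

text \<open>The cycle map is a Moebius transformation, so both cycle equations share the term
  \<open>a * x * y\<close>, and subtracting them leaves
  \<open>(y - x) * (1 - a * (1 + c)) = 0\<close>. The second factor is \<open>1 - a\<close> in the
  normal and \<open>(1 - a)^2\<close> in the misere game.\<close>

lemma geometric_no_draw:
  assumes a: "0 < a" "a < 1"
  shows "D_normal (geometric_pmf (1 - a)) = 0" "D_misere (geometric_pmf (1 - a)) = 0"
proof -
  let ?p = "geometric_pmf (1 - a)"
  have p0: "pmf ?p 0 = 1 - a" using a by simp
  have pos: "0 < 1 - a * x" if "x \<le> 1" for x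
    using that a mult_left_le[of x a] by linarith
  have no: "x = y" if "two_cycle (\<lambda>x. 1 - pgf ?p x + c) x y" "c = 0 \<or> c = 1 - a" for x y c
  proof -
    from that(1) have xy: "0 \<le> x" "x \<le> y" "y \<le> 1" "y = 1 - pgf ?p x + c" "x = 1 - pgf ?p y + c"
      by (auto simp: two_cycle_def)
    have "x \<le> 1" "0 \<le> y" using xy(1-3) by linarith+
    have y: "(y - 1 - c) * (1 - a * x) = - (1 - a)"
      using xy(4) pgf_geometric[OF a xy(1) \<open>x \<le> 1\<close>] pos[OF \<open>x \<le> 1\<close>] by (simp add: field_simps)
    have x: "(x - 1 - c) * (1 - a * y) = - (1 - a)"
      using xy(5) pgf_geometric[OF a \<open>0 \<le> y\<close> xy(3)] pos[OF xy(3)] by (simp add: field_simps)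
    have *: "(y - x) * (1 - a * (1 + c)) = 0"
      using x y by algebra
    have "1 - a * (1 + c) \<noteq> 0"
    proof
      assume eq: "1 - a * (1 + c) = 0"
      have "c = 1 - a"
        using that(2) eq a by auto
      with eq have "(1 - a)\<^sup>2 = 0" by algebra
      with a show False by simp
    qed
    with * show ?thesis by simp
  qed
  show "D_normal ?p = 0"
    by (rule max_cycle_width_eq_0[OF max_cycle_width_D_normal]) (use no[of 0] in simp)
  show "D_misere ?p = 0"
    by (rule max_cycle_width_eq_0[OF max_cycle_width_D_misere]) (use no[of "1 - a"] in \<open>simp only: p0 simp_thms\<close>)
qed

text \<open>Eliminating \<open>u\<close> from the two rational equations leaves \<open>v\<close>
  times factors that are nonzero because \<open>a < 1\<close> and \<open>a * v < 1\<close>.\<close>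

lemma geometric_no_escape:
  assumes a: "0 < a" "a < 1"
  shows "E1 (geometric_pmf (1 - a)) = 0" "E2 (geometric_pmf (1 - a)) = 0"
proof -
  let ?p = "geometric_pmf (1 - a)"
  define u v where "u = E2 ?p" and "v = E1 ?p"
  have b: "0 \<le> u" "u \<le> 1" "0 \<le> v" "v \<le> 1"
    by (simp_all add: u_def v_def E_bounds)
  have av: "a * v < 1" and au: "0 < 1 - a + a * u"
    using a b mult_left_le[of v a] mult_nonneg_nonneg[of a u] by linarith+
  have eqs: "v = 1 - pgf ?p (1 - u)" "u = pgf ?p v - (1 - a)"
    using E1_eq[of ?p] E2_eq[of ?p] a by (simp_all add: u_def v_def)
  have pgf_u: "pgf ?p (1 - u) = (1 - a) / (1 - a + a * u)"
    using pgf_geometric[OF a, of "1 - u"] b by (simp add: algebra_simps)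
  have pgf_v: "pgf ?p v = (1 - a) / (1 - a * v)"
    using pgf_geometric[OF a] b by simp
  have v: "v * (1 - a + a * u) = a * u"
    using eqs(1) au unfolding pgf_u by (simp add: field_simps)
  have u: "u * (1 - a * v) = (1 - a) * a * v"
    using eqs(2) av unfolding pgf_v by (simp add: field_simps)
  have "(1 - a) * v * (1 - a * v) = a * (1 - v) * (u * (1 - a * v))"
    using v by algebra
  then have "(1 - a)\<^sup>2 * v * ((1 + a) - a * v) = 0"
    unfolding u by algebra
  moreover have "(1 + a) - a * v \<noteq> 0"
    using av a by linarith
  ultimately have "v = 0" using a by simp
  moreover from this u have "u = 0" by simp
  ultimately show "E1 ?p = 0" "E2 ?p = 0"
    by (simp_all add: u_def v_def)
qed

section \<open>Rational bounds for the exponential function\<close>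

text \<open>\<open>exp_num a b n / (b ^ n * fact n)\<close> is the Taylor polynomial of degree \<open>n\<close> of \<open>exp\<close> at
  \<open>a / b\<close>; clearing denominators turns bounds on \<open>exp\<close> into comparisons of naturals.\<close>

primrec exp_num :: "nat \<Rightarrow> nat \<Rightarrow> nat \<Rightarrow> nat" where
  "exp_num a b 0 = 1"
| "exp_num a b (Suc n) = exp_num a b n * (b * Suc n) + a ^ Suc n"

lemma exp_num_numeral [simp]:
  "exp_num a b (numeral k) = exp_num a b (pred_numeral k) * (b * numeral k) + a ^ numeral k"
  by (simp only: numeral_eq_Suc exp_num.simps)

lemma exp_num_eq:
  assumes "b > 0"
  shows "real (exp_num a b n) = (\<Sum>k<Suc n. (real a / real b) ^ k / fact k) * (real b ^ n * fact n)"
proof (induction n)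
  case (Suc n)
  have "(\<Sum>k<Suc (Suc n). (real a / real b) ^ k / fact k) * (real b ^ Suc n * fact (Suc n)) =
      (\<Sum>k<Suc n. (real a / real b) ^ k / fact k) * (real b ^ n * fact n) * (real b * real (Suc n))
      + (real a / real b) ^ Suc n / fact (Suc n) * (real b ^ Suc n * fact (Suc n))"
    by (subst sum.lessThan_Suc) (simp add: algebra_simps)
  also have "(real a / real b) ^ Suc n / fact (Suc n) * (real b ^ Suc n * fact (Suc n)) = real a ^ Suc n"
    using assms by (simp add: power_divide del: fact_Suc)
  finally show ?case
    by (simp only: exp_num.simps Suc.IH[symmetric] of_nat_add of_nat_mult of_nat_power)
qed simp

text \<open>The remainder is controlled by \<open>exp 1 \<le> 3\<close>, hence the restriction
  \<open>x \<le> 1\<close>. Larger arguments are divided by 4 later and the resulting bound is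
  raised to the fourth power.\<close>

lemma Taylor_exp_bounds:
  assumes "0 \<le> x" "x \<le> (1::real)"
  shows "(\<Sum>k<n. x ^ k / fact k) \<le> exp x" "exp x \<le> (\<Sum>k<n. x ^ k / fact k) + 3 * x ^ n / fact n"
proof -
  obtain t where t: "\<bar>t\<bar> \<le> \<bar>x\<bar>" "exp x = (\<Sum>k<n. x ^ k / fact k) + exp t / fact n * x ^ n"
    using Maclaurin_exp_le[of x n] by blast
  have "exp t \<le> exp 1"
    using t(1) assms by simp
  also have "\<dots> \<le> 3" by (rule exp_le)
  finally have "exp t / fact n * x ^ n \<le> 3 / fact n * x ^ n"
    using assms by (intro mult_right_mono divide_right_mono) auto
  with t(2) show "exp x \<le> (\<Sum>k<n. x ^ k / fact k) + 3 * x ^ n / fact n"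
    by simp
  have "0 \<le> exp t / fact n * x ^ n"
    using assms by simp
  with t(2) show "(\<Sum>k<n. x ^ k / fact k) \<le> exp x"
    by simp
qed

lemma exp_ge_ratI:
  assumes "u * (b ^ n * fact n) \<le> v * exp_num a b n" "a \<le> b" "0 < b" "0 < v"
  shows "real u / real v \<le> exp (real a / real b)"
proof -
  have "real (u * (b ^ n * fact n)) \<le> real (v * exp_num a b n)"
    using assms(1) by (simp only: of_nat_le_iff)
  then have "real u \<le> real v * (\<Sum>k<Suc n. (real a / real b) ^ k / fact k)"
    using assms(3) by (simp add: exp_num_eq del: sum.lessThan_Suc)
  also have "\<dots> \<le> real v * exp (real a / real b)"
    using assms by (intro mult_left_mono Taylor_exp_bounds) auto
  finally show ?thesis
    using assms(4) by (simp add: divide_le_eq mult.commute)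
qed

lemma exp_le_ratI:
  assumes "v * (exp_num a b n * (b * Suc n) + 3 * a ^ Suc n) \<le> u * (b ^ Suc n * fact (Suc n))"
    "a \<le> b" "0 < b" "0 < v"
  shows "exp (real a / real b) \<le> real u / real v"
proof -
  let ?S = "\<Sum>k<Suc n. (real a / real b) ^ k / fact k"
  let ?c = "real b ^ Suc n * fact (Suc n)"
  have c: "?c > 0" using assms(3) by simp
  have "real (v * (exp_num a b n * (b * Suc n) + 3 * a ^ Suc n)) \<le> real (u * (b ^ Suc n * fact (Suc n)))"
    using assms(1) by (simp only: of_nat_le_iff)
  also have "real (u * (b ^ Suc n * fact (Suc n))) = real u * ?c"
    by (simp only: of_nat_mult of_nat_power of_nat_fact)
  also have "real (v * (exp_num a b n * (b * Suc n) + 3 * a ^ Suc n)) =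
      real v * (?S * (real b ^ n * fact n) * (real b * real (Suc n)) + 3 * real a ^ Suc n)"
    by (simp only: of_nat_mult of_nat_add of_nat_power of_nat_numeral exp_num_eq[OF assms(3)])
  also have "?S * (real b ^ n * fact n) * (real b * real (Suc n)) = ?S * ?c"
    by (simp add: algebra_simps del: sum.lessThan_Suc)
  also have "3 * real a ^ Suc n = 3 * (real a / real b) ^ Suc n / fact (Suc n) * ?c"
    using assms(3) by (simp add: power_divide del: fact_Suc)
  finally have "real v * (?S + 3 * (real a / real b) ^ Suc n / fact (Suc n)) * ?c \<le> real u * ?c"
    by (simp only: distrib_right mult.assoc)
  with c have "real v * (?S + 3 * (real a / real b) ^ Suc n / fact (Suc n)) \<le> real u"
    by (simp only: mult_le_cancel_right_pos)
  moreover have "real v * exp (real a / real b) \<le> real v * (?S + 3 * (real a / real b) ^ Suc n / fact (Suc n))"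
    using assms by (intro mult_left_mono Taylor_exp_bounds) auto
  ultimately have "real v * exp (real a / real b) \<le> real u"
    by (rule order_trans[rotated])
  then show ?thesis
    using assms(4) by (simp add: le_divide_eq mult.commute)
qed

text \<open>The first two bounds concern quarters of 3.318501 and 3.31854, values close to the
  escape threshold. The next four bound \<open>exp s / s\<close> at the ends of the bracket for
  \<open>s\<close>, and the two after them the logarithms of these ends. The last four serve the
  misere threshold.\<close>

lemma exp_num_bounds:
  "exp (0.82962525 :: real) \<le> 2.2924594802"
  "exp (0.829635 :: real) \<ge> 2.29248183"
  "exp (0.4937138 :: real) \<le> 3.318501 * 0.4937138"
  "exp (0.4937138 :: real) \<ge> 3.3185 * 0.4937138"
  "exp (0.4937 :: real) \<le> 3.3195 * 0.4937"
  "exp (0.4937 :: real) \<ge> 3.31854 * 0.4937"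
  "exp (0.70579928 :: real) \<le> 1 / 0.4937138"
  "exp (0.70582724 :: real) \<ge> 1 / 0.4937"
  "exp (0.743128 :: real) \<ge> 2.1025"
  "exp (0.743602 :: real) \<le> 2.1035"
  "exp (0.525625 :: real) \<ge> 1.6915"
  "exp (0.525875 :: real) \<le> 1.69196"
proof -
  show "exp (0.82962525 :: real) \<le> 2.2924594802"
    \<comment> \<open>The instances are \<open>v\<close>, \<open>a\<close>, \<open>b\<close>,
      \<open>n\<close>, \<open>u\<close>: the argument is \<open>a / b\<close>, the bound
      \<open>u / v\<close>, and \<open>n\<close> is a Taylor degree precise enough for it. For
      \<open>exp_ge_ratI\<close> the order is \<open>u\<close>, \<open>b\<close>, \<open>n\<close>,
      \<open>v\<close>, \<open>a\<close>.\<close>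
    using exp_le_ratI[of 5000000000 3318501 4000000 12 11462297401]
    by (simp add: fact_numeral)
  show "exp (0.829635 :: real) \<ge> 2.29248183"
    using exp_ge_ratI[of 229248183 200000 11 100000000 165927]
    by (simp add: fact_numeral)
  show "exp (0.4937138 :: real) \<le> 3.318501 * 0.4937138"
    using exp_le_ratI[of 5000000000000 2468569 5000000 8 8191948695069]
    by (simp add: fact_numeral)
  show "exp (0.4937138 :: real) \<ge> 3.3185 * 0.4937138"
    using exp_ge_ratI[of 16383892453 5000000 7 10000000000 2468569]
    by (simp add: fact_numeral)
  show "exp (0.4937 :: real) \<le> 3.3195 * 0.4937"
    using exp_le_ratI[of 20000000 4937 10000 4 32776743]
    by (simp add: fact_numeral)
  show "exp (0.4937 :: real) \<ge> 3.31854 * 0.4937"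
    using exp_ge_ratI[of 819181599 10000 6 500000000 4937]
    by (simp add: fact_numeral)
  show "exp (0.70579928 :: real) \<le> 1 / 0.4937138"
    using exp_le_ratI[of 2468569 8822491 12500000 10 5000000]
    by (simp add: fact_numeral)
  show "exp (0.70582724 :: real) \<ge> 1 / 0.4937"
    using exp_ge_ratI[of 10000 25000000 9 4937 17645681]
    by (simp add: fact_numeral)
  show "exp (0.743128 :: real) \<ge> 2.1025"
    using exp_ge_ratI[of 841 125000 8 400 92891]
    by (simp add: fact_numeral)
  show "exp (0.743602 :: real) \<le> 2.1035"
    using exp_le_ratI[of 2000 371801 500000 8 4207]
    by (simp add: fact_numeral)
  show "exp (0.525625 :: real) \<ge> 1.6915"
    using exp_ge_ratI[of 3383 1600 6 2000 841]
    by (simp add: fact_numeral)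
  show "exp (0.525875 :: real) \<le> 1.69196"
    using exp_le_ratI[of 25000 4207 8000 6 42299]
    by (simp add: fact_numeral)
qed

section \<open>Poisson offspring: the normal and misere games\<close>

lemma pgf_poisson:
  assumes "l > 0"
  shows "pgf (poisson_pmf l) x = exp (l * (x - 1))"
proof -
  have "(\<lambda>k. exp (- l) * ((l * x) ^ k /\<^sub>R fact k)) sums (exp (- l) * exp (l * x))"
    by (intro sums_mult exp_converges)
  moreover have "pmf (poisson_pmf l) k * x ^ k = exp (- l) * ((l * x) ^ k /\<^sub>R fact k)" for k
    using assms by (simp add: power_mult_distrib divide_inverse)
  ultimately have "pgf (poisson_pmf l) x = exp (- l) * exp (l * x)"
    by (simp add: pgf_def sums_iff)
  then show ?thesis
    by (simp add: exp_add[symmetric] algebra_simps)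
qed

section \<open>The unimodal function \<open>z * exp (- z)\<close>, with its maximum at 1\<close>

lemma times_exp_minus_le: "z * exp (- z) \<le> exp (- 1)" for z :: real
proof -
  have "z \<le> exp (z - 1)"
    using exp_ge_add_one_self[of "z - 1"] by simp
  then have "z * exp (- z) \<le> exp (z - 1) * exp (- z)"
    by (intro mult_right_mono) auto
  then show ?thesis by (simp add: exp_add[symmetric])
qed

lemma times_exp_minus_eqD:
  assumes "exp (- 1) \<le> z * exp (- z)"
  shows "z = (1::real)"
proof -
  have "0 < z * exp (- z)"
    using assms exp_gt_zero[of "- 1 :: real"] by linarith
  then have "z > 0"
    by (simp add: zero_less_mult_iff)
  have "ln (exp (- 1)) \<le> ln (z * exp (- z))"
    using assms by (intro ln_mono) auto
  then have "z - 1 \<le> ln z"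
    using \<open>z > 0\<close> by (simp add: ln_mult)
  with ln_le_minus_one[OF \<open>z > 0\<close>] have "ln z = z - 1" by linarith
  then show ?thesis
    using ln_eq_minus_one[OF \<open>z > 0\<close>] by simp
qed

lemma times_exp_minus_strict_mono:
  fixes s t :: real
  assumes "s < t" "t \<le> 1"
  shows "s * exp (- s) < t * exp (- t)"
proof (rule DERIV_pos_imp_increasing_open[OF assms(1)])
  fix x assume "s < x" "x < t"
  then show "\<exists>y. ((\<lambda>s. s * exp (- s)) has_real_derivative y) (at x) \<and> 0 < y"
    using assms by (intro exI[of _ "exp (- x) * (1 - x)"]) (auto intro!: derivative_eq_intros simp: algebra_simps)
qed (intro continuous_intros)

lemma times_exp_minus_strict_antimono:
  fixes s t :: real
  assumes "s < t" "1 \<le> s"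
  shows "t * exp (- t) < s * exp (- s)"
proof (rule DERIV_neg_imp_decreasing_open[OF assms(1)])
  fix x assume "s < x" "x < t"
  then show "\<exists>y. ((\<lambda>s. s * exp (- s)) has_real_derivative y) (at x) \<and> y < 0"
    using assms by (intro exI[of _ "exp (- x) * (1 - x)"])
      (auto intro!: derivative_eq_intros simp: algebra_simps mult_less_cancel_left_pos)
qed (intro continuous_intros)

lemma times_exp_minus_antimono:
  fixes s t :: real
  assumes "s \<le> t" "1 \<le> s"
  shows "t * exp (- t) \<le> s * exp (- s)"
  using times_exp_minus_strict_antimono[of s t] assms by (cases "s = t") auto

text \<open>For \<open>f z = exp (- l * z) - c\<close> and \<open>w = l * (f z + c)\<close>, the derivative of \<open>f \<circ> f\<close> at \<open>z\<close> is
  \<open>l * exp (l * c) * (w * exp (- w))\<close>, which is at most \<open>l * exp (l * c) / exp 1\<close>. So below the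
  threshold \<open>f \<circ> f\<close> has only the fixed point of \<open>f\<close>, while above it that point repels.\<close>

lemma exp_two_cycle_iff:
  fixes l c :: real
  assumes l: "l > 0" and c: "0 \<le> c" "c \<le> exp (- l)"
  shows "(\<exists>a b. 0 \<le> b \<and> b < a \<and> a \<le> 1 \<and> exp (- l * a) - c = b \<and> exp (- l * b) - c = a) \<longleftrightarrow>
    l * exp (l * c) > exp 1"
proof -
  define f where "f z = exp (- l * z) - c" for z
  define g where "g z = f (f z) - z" for z
  define L where "L = l * exp (l * c)"
  define w where "w z = l * exp (- l * z)" for z
  have "L > 0" using l by (simp add: L_def)
  have f_anti: "f z < f y" if "y < z" for y z
    using that l by (simp add: f_def)
  have f_bounds: "0 \<le> f z" "f z \<le> 1" if "0 \<le> z" "z \<le> 1" for z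
  proof -
    have "exp (- l) \<le> exp (- l * z)" "exp (- l * z) \<le> 1"
      using that l by (auto simp: mult_left_le)
    with c show "0 \<le> f z" "f z \<le> 1" unfolding f_def by linarith+
  qed
  have cont_f: "continuous_on A f" for A
    unfolding f_def by (intro continuous_intros)
  have cont_g: "continuous_on A g" for A
    unfolding g_def f_def by (intro continuous_intros)
  have deriv_g: "(g has_real_derivative L * (w z * exp (- w z)) - 1) (at z)" for z
  proof -
    have "(g has_real_derivative l * exp (- l * z) * (l * exp (- l * f z)) - 1) (at z)"
      unfolding g_def f_def by (auto intro!: derivative_eq_intros)
    moreover have "l * exp (- l * z) * (l * exp (- l * f z)) - 1 = L * (w z * exp (- w z)) - 1"
    proof -
      have "exp (- l * f z) = exp (l * c) * exp (- w z)"
        by (simp add: exp_add[symmetric] f_def w_def algebra_simps)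
      then show ?thesis by (simp add: L_def w_def)
    qed
    ultimately show ?thesis by simp
  qed
  have fixp: "\<exists>x\<ge>y. x \<le> z \<and> f x = x" if "y \<le> z" "y \<le> f y" "f z \<le> z" for y z
  proof -
    have "\<exists>x\<ge>y. x \<le> z \<and> f x - x = 0"
      using that by (intro IVT2' continuous_intros cont_f) auto
    then show ?thesis by auto
  qed
  show ?thesis
  proof
    assume "\<exists>a b. 0 \<le> b \<and> b < a \<and> a \<le> 1 \<and> exp (- l * a) - c = b \<and> exp (- l * b) - c = a"
    then obtain a b where ab: "b < a" "f a = b" "f b = a"
      by (auto simp: f_def)
    obtain x where x: "b \<le> x" "x \<le> a" "f x = x"
      using fixp[of b a] ab by auto
    have "x \<noteq> a" "x \<noteq> b"
      using x ab by auto
    have g0: "g a = 0" "g b = 0" "g x = 0"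
      using ab x by (simp_all add: g_def)
    have crit: "\<exists>z. y < z \<and> z < y' \<and> L * (w z * exp (- w z)) = 1" if less: "y < y'" and eq0: "g y = 0" "g y' = 0" for y y'
    proof -
      obtain z where "y < z" "z < y'" "g y' - g y = (y' - y) * (L * (w z * exp (- w z)) - 1)"
        using MVT2[OF less, of g "\<lambda>z. L * (w z * exp (- w z)) - 1"] deriv_g by blast
      with less eq0 show ?thesis by auto
    qed
    \<comment> \<open>Rolle's theorem on both sides of the fixed point gives two critical points. If
      \<open>L \<le> exp 1\<close>, both would satisfy \<open>w z = 1\<close>, which has at most one
      solution.\<close>
    obtain z1 where z1: "b < z1" "z1 < x" "L * (w z1 * exp (- w z1)) = 1"
      using crit[of b x] g0 x(1) \<open>x \<noteq> b\<close> by auto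
    obtain z2 where z2: "x < z2" "z2 < a" "L * (w z2 * exp (- w z2)) = 1"
      using crit[of x a] g0 x(2) \<open>x \<noteq> a\<close> by auto
    have "exp 1 < L"
    proof (rule ccontr)
      assume "\<not> exp 1 < L"
      then have *: "w z = 1" if "L * (w z * exp (- w z)) = 1" for z
      proof -
        have "w z * exp (- w z) = 1 / L"
          using that \<open>L > 0\<close> by (simp add: field_simps)
        moreover have "exp (- 1) \<le> 1 / L"
          using \<open>\<not> exp 1 < L\<close> \<open>L > 0\<close> by (simp add: exp_minus field_simps)
        ultimately show ?thesis
          by (intro times_exp_minus_eqD) simp
      qed
      have "w z1 = w z2"
        using *[OF z1(3)] *[OF z2(3)] by simp
      with l have "z1 = z2" by (simp add: w_def)
      with z1 z2 show False by simp
    qed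
    then show "l * exp (l * c) > exp 1" by (simp add: L_def)
  next
    assume "l * exp (l * c) > exp 1"
    then have L: "L > exp 1" by (simp add: L_def)
    obtain x where x: "0 \<le> x" "x \<le> 1" "f x = x"
      using fixp[of 0 1] f_bounds[of 0] f_bounds[of 1] by auto
    have "exp (- l) < 1" using l by simp
    with c(2) have "c < 1" by linarith
    then have "f 0 > 0" by (simp add: f_def)
    with x have "x > 0" by (cases "x = 0") auto
    have w: "w x = l * (x + c)"
      using x(3) by (simp add: w_def f_def)
    have L_eq: "L = w x * exp (w x)"
    proof -
      have "w x * exp (w x) = l * (exp (- l * x) * exp (l * (x + c)))"
        unfolding w[symmetric] by (simp add: w_def)
      also have "exp (- l * x) * exp (l * (x + c)) = exp (l * c)"
        by (simp add: exp_add[symmetric] algebra_simps)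
      finally show ?thesis by (simp add: L_def)
    qed
    have "w x > 1"
    proof (rule ccontr)
      assume "\<not> w x > 1"
      then have "w x * exp (w x) \<le> 1 * exp 1"
        using l by (intro mult_mono) (auto simp: w_def)
      with L L_eq show False by simp
    qed
    \<comment> \<open>By \<open>L_eq\<close> the derivative of \<open>g\<close> at the fixed point
      is \<open>w x * w x - 1\<close>. So \<open>g\<close> is negative just left of
      \<open>x\<close>, and as \<open>g 0 \<ge> 0\<close> it has a further zero there: the lower
      point of the cycle.\<close>
    then have "L * (w x * exp (- w x)) - 1 > 0"
      unfolding L_eq by (simp add: mult.commute mult.left_commute exp_minus less_1_mult)
    from DERIV_pos_inc_left[OF deriv_g this] obtain d where
      d: "d > 0" "\<And>h. 0 < h \<Longrightarrow> h < d \<Longrightarrow> g (x - h) < g x" by blast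
    define y where "y = x - min (d / 2) x"
    have y: "0 \<le> y" "y < x" "g y < 0"
      using d(1) d(2)[of "min (d / 2) x"] x \<open>x > 0\<close> by (auto simp: y_def g_def)
    have "g 0 \<ge> 0"
      using f_bounds(1)[of "f 0"] f_bounds[of 0] by (simp add: g_def)
    with y obtain b where b: "0 \<le> b" "b \<le> y" "g b = 0"
      using IVT2'[of g y 0 0, OF _ _ _ cont_g] by auto
    have "f b > f x"
      using f_anti b y by simp
    then have "b < f b"
      using x(3) b y by simp
    moreover have "f (f b) = b"
      using b by (simp add: g_def)
    moreover have "f b \<le> 1"
      using f_bounds[of b] b y x by simp
    ultimately show "\<exists>a b. 0 \<le> b \<and> b < a \<and> a \<le> 1 \<and> exp (- l * a) - c = b \<and> exp (- l * b) - c = a"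
      using b(1) by (intro exI[of _ "f b"] exI[of _ b]) (auto simp: f_def)
  qed
qed

text \<open>Passing to complements \<open>1 - x\<close> conjugates the cycle map to
  \<open>exp (- l * z) - c\<close>. The normal game has \<open>c = 0\<close>, the misere game
  \<open>c = exp (- l)\<close>.\<close>

lemma two_cycle_poisson_iff:
  assumes l: "l > 0" and c: "0 \<le> c" "c \<le> exp (- l)"
  shows "(\<exists>x y. two_cycle (\<lambda>x. 1 - exp (l * (x - 1)) + c) x y \<and> x < y) \<longleftrightarrow> l * exp (l * c) > exp 1"
proof -
  have "(\<exists>x y. two_cycle (\<lambda>x. 1 - exp (l * (x - 1)) + c) x y \<and> x < y) \<longleftrightarrow>
    (\<exists>a b. 0 \<le> b \<and> b < a \<and> a \<le> 1 \<and> exp (- l * a) - c = b \<and> exp (- l * b) - c = a)"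
  proof (intro iffI; elim exE conjE)
    fix x y assume "two_cycle (\<lambda>x. 1 - exp (l * (x - 1)) + c) x y" "x < y"
    then show "\<exists>a b. 0 \<le> b \<and> b < a \<and> a \<le> 1 \<and> exp (- l * a) - c = b \<and> exp (- l * b) - c = a"
      by (intro exI[of _ "1 - x"] exI[of _ "1 - y"]) (auto simp: two_cycle_def algebra_simps)
  next
    fix a b assume "0 \<le> b" "b < a" "a \<le> 1" "exp (- l * a) - c = b" "exp (- l * b) - c = a"
    then show "\<exists>x y. two_cycle (\<lambda>x. 1 - exp (l * (x - 1)) + c) x y \<and> x < y"
      by (intro exI[of _ "1 - a"] exI[of _ "1 - b"]) (auto simp: two_cycle_def algebra_simps)
  qed
  with exp_two_cycle_iff[OF assms] show ?thesis by simp
qed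

lemma max_cycle_width_poisson:
  assumes "l > 0"
  shows "max_cycle_width (\<lambda>x. 1 - exp (l * (x - 1)) + 0) (D_normal (poisson_pmf l))"
    and "max_cycle_width (\<lambda>x. 1 - exp (l * (x - 1)) + exp (- l)) (D_misere (poisson_pmf l))"
  using max_cycle_width_D_normal[of "poisson_pmf l"] max_cycle_width_D_misere[of "poisson_pmf l"] assms
  by (simp_all add: pgf_poisson)

lemma D_normal_poisson_pos_iff:
  assumes "l > 0"
  shows "D_normal (poisson_pmf l) > 0 \<longleftrightarrow> l > exp 1"
  unfolding max_cycle_width_pos_iff[OF max_cycle_width_poisson(1)[OF assms]]
  by (subst two_cycle_poisson_iff) (use assms in auto)

lemma D_misere_poisson_pos_iff:
  assumes "l > 0"
  shows "D_misere (poisson_pmf l) > 0 \<longleftrightarrow> l * exp (l * exp (- l)) > exp 1"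
  unfolding max_cycle_width_pos_iff[OF max_cycle_width_poisson(2)[OF assms]]
  by (subst two_cycle_poisson_iff) (use assms in auto)

lemma D_normal_poisson_tendsto:
  "((\<lambda>l. D_normal (poisson_pmf l)) \<longlongrightarrow> 0) (at_right (exp 1))"
proof (rule max_cycle_width_tendsto_0[of _ "exp 1 + 1" "\<lambda>l x. 1 - exp (l * (x - 1)) + 0"])
  show "x = y" if "two_cycle (\<lambda>x. 1 - exp (exp 1 * (x - 1)) + 0) x y" for x y
    using two_cycle_poisson_iff[of "exp 1" 0] that two_cycle_le[OF that]
    by (auto simp: order_le_less)
  show "max_cycle_width (\<lambda>x. 1 - exp (l * (x - 1)) + 0) (D_normal (poisson_pmf l))"
    if "exp 1 < l" for l
    by (rule max_cycle_width_poisson) (use that exp_gt_zero[of "1::real"] in linarith)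
qed (auto intro!: continuous_intros)

lemma D_misere_poisson_tendsto:
  assumes "m > 0" "m * exp (m * exp (- m)) = exp 1"
  shows "((\<lambda>l. D_misere (poisson_pmf l)) \<longlongrightarrow> 0) (at_right m)"
proof (rule max_cycle_width_tendsto_0[of _ "m + 1" "\<lambda>l x. 1 - exp (l * (x - 1)) + exp (- l)"])
  show "x = y" if "two_cycle (\<lambda>x. 1 - exp (m * (x - 1)) + exp (- m)) x y" for x y
    using two_cycle_poisson_iff[of m "exp (- m)"] that two_cycle_le[OF that] assms
    by (auto simp: order_le_less)
  show "max_cycle_width (\<lambda>x. 1 - exp (l * (x - 1)) + exp (- l)) (D_misere (poisson_pmf l))"
    if "m < l" for l
    by (rule max_cycle_width_poisson) (use that assms in linarith)
qed (auto intro!: continuous_intros)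

text \<open>This function is the logarithm of the quantity that the misere criterion compares with
  \<open>exp 1\<close>. Its derivative is positive because
  \<open>x * (x - 1) < exp x\<close>.\<close>

lemma misere_threshold_strict_mono:
  assumes "0 < l" "l < (m::real)"
  shows "ln l + l * exp (- l) < ln m + m * exp (- m)"
proof (rule DERIV_pos_imp_increasing_open[OF assms(2)])
  fix x assume "l < x" "x < m"
  then have x: "x > 0" using assms by simp
  have "0 < 1 / x + exp (- x) * (1 - x)"
  proof -
    have "x * exp (- x) * (x - 1) < 1"
    proof (cases "x \<le> 1")
      case True
      then have "x * exp (- x) * (x - 1) \<le> 0"
        using x by (intro mult_nonneg_nonpos) auto
      then show ?thesis by linarith
    next
      case False
      then have x1: "x > 1" by simp
      \<comment> \<open>Squaring this gives \<open>x * x \<le> 4 * exp (- 2) * exp x\<close>, and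
        \<open>exp 2 \<ge> 4\<close>.\<close>
      have "x / 2 \<le> exp (x / 2 - 1)"
        using exp_ge_add_one_self[of "x / 2 - 1"] by simp
      then have "(x / 2) * (x / 2) \<le> exp (x / 2 - 1) * exp (x / 2 - 1)"
        using x by (intro mult_mono) auto
      also have "\<dots> = exp x * exp (- 2)"
        by (simp add: exp_add[symmetric])
      also have "exp (- 2) \<le> (1 / 4 :: real)"
      proof -
        have "(2::real) * 2 \<le> exp 1 * exp 1"
          using exp_ge_add_one_self[of 1] by (intro mult_mono) auto
        then have "4 \<le> exp (2::real)" by (simp add: exp_add[symmetric])
        then show ?thesis by (simp add: exp_minus field_simps)
      qed
      finally have "x * x \<le> exp x" by simp
      moreover have "x * (x - 1) < x * x"
        using x by simp
      ultimately have "x * (x - 1) < exp x" by linarith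
      then show ?thesis by (simp add: exp_minus field_simps)
    qed
    then show ?thesis
      using x by (simp add: field_simps)
  qed
  then show "\<exists>y. ((\<lambda>l. ln l + l * exp (- l)) has_real_derivative y) (at x) \<and> 0 < y"
    using x by (intro exI[of _ "1 / x + exp (- x) * (1 - x)"])
      (auto intro!: derivative_eq_intros simp: algebra_simps divide_inverse)
qed (use assms in \<open>auto intro!: continuous_intros\<close>)

text \<open>The two ends of the tolerance interval already bracket the root, so the intermediate
  value theorem gives existence and accuracy together.\<close>

lemma ex_misere_threshold:
  "\<exists>m::real. \<bar>m - 2.103\<bar> \<le> 0.0005 \<and> ln m + m * exp (- m) = 1"
proof -
  define k where "k m = ln m + m * exp (- m)" for m :: real
  have "k 2.1025 \<le> 1"
  proof -
    have "ln 2.1025 \<le> (0.743128 :: real)"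
      using ln_mono[OF exp_num_bounds(9)] by simp
    moreover have "1.6915 ^ 4 \<le> exp (0.525625 :: real) ^ 4"
      by (intro power_mono exp_num_bounds) auto
    then have "8.186 \<le> exp (2.1025 :: real)"
      by (simp add: exp_of_nat_mult[symmetric] power_divide)
    then have "2.1025 * exp (- 2.1025) \<le> (2.1025 / 8.186 :: real)"
      by (simp add: exp_minus field_simps)
    ultimately show ?thesis by (simp add: k_def)
  qed
  moreover have "1 \<le> k 2.1035"
  proof -
    have "0.743602 \<le> ln (2.1035 :: real)"
      using ln_mono[OF exp_num_bounds(10)] by simp
    moreover have "exp (0.525875 :: real) ^ 4 \<le> 1.69196 ^ 4"
      by (intro power_mono exp_num_bounds) auto
    then have "exp (2.1035 :: real) \<le> 8.196"
      by (simp add: exp_of_nat_mult[symmetric] power_divide)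
    then have "(2.1035 / 8.196 :: real) \<le> 2.1035 * exp (- 2.1035)"
      by (simp add: exp_minus field_simps)
    ultimately show ?thesis by (simp add: k_def)
  qed
  moreover have "continuous_on {2.1025..2.1035} k"
    unfolding k_def by (auto intro!: continuous_intros)
  ultimately obtain m where "2.1025 \<le> m" "m \<le> 2.1035" "k m = 1"
    using IVT'[of k "2.1025" 1 "2.1035"] by auto
  then show ?thesis
    unfolding abs_le_iff by (intro exI[of _ m]) (auto simp: k_def)
qed

lemma misere_threshold:
  fixes l m :: real
  assumes m: "0 < m" "ln m + m * exp (- m) = 1" and l: "0 < l"
  shows "l = exp (1 - l * exp (- l)) \<longleftrightarrow> l = m"
    and "l * exp (l * exp (- l)) > exp 1 \<longleftrightarrow> l > m"
proof -
  let ?k = "\<lambda>l. ln l + l * exp (- l)"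
  have less: "?k l < ?k l' \<longleftrightarrow> l < l'" if "0 < l" "0 < l'" for l l' :: real
    using misere_threshold_strict_mono[of l l'] misere_threshold_strict_mono[of l' l] that
    by (metis less_asym linorder_neqE_linordered_idom)
  have "l = exp (1 - l * exp (- l)) \<longleftrightarrow> ln l = ln (exp (1 - l * exp (- l)))"
    using l by (intro ln_inj_iff[symmetric]) auto
  also have "\<dots> \<longleftrightarrow> ?k l = ?k m"
    using m(2) by (auto simp: algebra_simps)
  also have "\<dots> \<longleftrightarrow> l = m"
    using less[OF l m(1)] less[OF m(1) l] by (metis linorder_neqE_linordered_idom less_irrefl)
  finally show "l = exp (1 - l * exp (- l)) \<longleftrightarrow> l = m" .
  have "l * exp (l * exp (- l)) > exp 1 \<longleftrightarrow> ln (exp 1) < ln (l * exp (l * exp (- l)))"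
    using l by (intro ln_less_cancel_iff[symmetric]) auto
  also have "\<dots> \<longleftrightarrow> ?k m < ?k l"
    using l m(2) by (simp add: ln_mult)
  also have "\<dots> \<longleftrightarrow> l > m"
    by (rule less[OF m(1) l])
  finally show "l * exp (l * exp (- l)) > exp 1 \<longleftrightarrow> l > m" .
qed

section \<open>Poisson offspring: the escape game\<close>

lemma E_poisson_eq:
  assumes "l > 0"
  shows "E1 (poisson_pmf l) = 1 - exp (- l * E2 (poisson_pmf l))"
    and "E2 (poisson_pmf l) = exp (l * (E1 (poisson_pmf l) - 1)) - exp (- l)"
  by (subst E1_eq E2_eq, simp add: pgf_poisson assms)+

lemma E_poisson_pos_iff:
  assumes "l > 0"
  shows "E1 (poisson_pmf l) > 0 \<longleftrightarrow> E2 (poisson_pmf l) > 0"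
proof -
  have "E1 (poisson_pmf l) > 0 \<longleftrightarrow> - l * E2 (poisson_pmf l) < 0"
    by (subst E_poisson_eq(1)[OF assms]) (simp only: diff_gt_0_iff_gt exp_less_one_iff)
  then show ?thesis
    using assms by (simp add: zero_less_mult_iff)
qed

text \<open>With \<open>s = l * (1 - E1)\<close> the fixed point equations of the escape game become
  \<open>escape_fun l s = escape_fun l l\<close>; the solution \<open>s = l\<close> is the one with \<open>E1 = 0\<close>.\<close>

definition escape_fun :: "real \<Rightarrow> real \<Rightarrow> real" where
  "escape_fun l s = l * exp (- s) + ln s"

lemma E2_poisson_posI:
  assumes s: "0 < s" "s < l" and ge: "escape_fun l l \<le> escape_fun l s"
  shows "E2 (poisson_pmf l) > 0"
proof -
  have l: "l > 0" using s by simp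
  \<comment> \<open>\<open>v\<close> is the value of \<open>E1\<close> that corresponds to
    \<open>s\<close>, and \<open>u\<close> solves the equation of \<open>E2\<close> for it exactly.
    The hypothesis on \<open>escape_fun\<close> only supplies the other equation as an inequality,
    which a subsolution permits.\<close>
  define u v where "u = exp (- s) - exp (- l)" and "v = 1 - s / l"
  have "u > 0" using s by (simp add: u_def)
  have "exp (- s) \<le> 1" using s by simp
  then have "u \<le> 1" using exp_gt_zero[of "- l"] unfolding u_def by linarith
  have "l * (v - 1) = - s" using l by (simp add: v_def)
  then have u: "u = pgf (poisson_pmf l) v - pmf (poisson_pmf l) 0"
    using l by (simp add: u_def pgf_poisson)
  have "- l * u \<le> ln (s / l)"
    using ge s by (simp add: u_def escape_fun_def ln_div algebra_simps)
  then have "exp (- l * u) \<le> s / l"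
    using s by (simp add: ln_ge_iff)
  then have v: "v \<le> 1 - pgf (poisson_pmf l) (1 - u)"
    using l by (simp add: v_def pgf_poisson)
  have "u \<le> E2 (poisson_pmf l)"
    using E_greatest(2)[of u v "poisson_pmf l"] \<open>u > 0\<close> \<open>u \<le> 1\<close> s u v
    by (simp add: v_def)
  with \<open>u > 0\<close> show ?thesis by simp
qed

lemma E2_poisson_posD:
  assumes l: "l > 0" and pos: "E2 (poisson_pmf l) > 0"
  shows "\<exists>s. 0 < s \<and> s < l \<and> escape_fun l s = escape_fun l l"
proof -
  define u v where "u = E2 (poisson_pmf l)" and "v = E1 (poisson_pmf l)"
  have eqs: "v = 1 - exp (- l * u)" "u = exp (l * (v - 1)) - exp (- l)"
    unfolding u_def v_def using E_poisson_eq[OF l] .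
  have "v > 0" using pos E_poisson_pos_iff[OF l] by (simp add: v_def)
  have 1: "1 - v = exp (- l * u)" using eqs(1) by linarith
  then have "1 - v > 0" by simp
  define s where "s = l * (1 - v)"
  have "s > 0" "s < l"
    using l \<open>1 - v > 0\<close> \<open>v > 0\<close> by (simp_all add: s_def)
  have "ln s = ln l + ln (1 - v)"
    using l \<open>1 - v > 0\<close> by (simp add: s_def ln_mult)
  also have "ln (1 - v) = - l * u"
    unfolding 1 by simp
  also have "u = exp (- s) - exp (- l)"
    using eqs(2) by (simp add: s_def algebra_simps)
  finally have "escape_fun l s = escape_fun l l"
    by (simp add: escape_fun_def algebra_simps)
  with \<open>s > 0\<close> \<open>s < l\<close> show ?thesis by blast
qed

text \<open>Factored so that the sign is that of \<open>1 / l - s * exp (- s)\<close>, which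
  unimodality of \<open>s * exp (- s)\<close> controls.\<close>

lemma escape_fun_deriv:
  assumes "s > 0" "l > 0"
  shows "(escape_fun l has_real_derivative (l / s) * (1 / l - s * exp (- s))) (at s)"
proof -
  have "(escape_fun l has_real_derivative l * (- exp (- s)) + 1 / s) (at s)"
    unfolding escape_fun_def[abs_def] using assms(1)
    by (auto intro!: derivative_eq_intros simp: divide_inverse)
  moreover have "l * (- exp (- s)) + 1 / s = (l / s) * (1 / l - s * exp (- s))"
    using assms by (simp add: field_simps)
  ultimately show ?thesis by simp
qed

lemma escape_fun_MVT:
  assumes "0 < s" "s < t" "l > 0"
  obtains c where "s < c" "c < t"
    "escape_fun l t - escape_fun l s = (t - s) * ((l / c) * (1 / l - c * exp (- c)))"
  using MVT2[OF assms(2), of "escape_fun l" "\<lambda>c. (l / c) * (1 / l - c * exp (- c))"]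
    escape_fun_deriv[of _ l] assms by auto

text \<open>For these \<open>l\<close> the derivative is nonnegative and can vanish only at 1. Equal
  values at \<open>s\<close> and \<open>l\<close> would make it vanish at two points, one on each
  side of the midpoint.\<close>

lemma escape_fun_neq_if_le_exp_1:
  assumes s: "0 < s" "s < l" and l: "l \<le> exp 1"
  shows "escape_fun l s \<noteq> escape_fun l l"
proof
  assume eq: "escape_fun l s = escape_fun l l"
  have "l > 0" using s by simp
  have ge: "exp (- 1) \<le> 1 / l"
    using l \<open>l > 0\<close> by (simp add: exp_minus field_simps)
  have le: "c * exp (- c) \<le> 1 / l" for c
    using times_exp_minus_le[of c] ge by linarith
  have eq1: "c = 1" if "c * exp (- c) = 1 / l" for c
    using ge that by (intro times_exp_minus_eqD) simp
  define m where "m = (s + l) / 2"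
  have m: "s < m" "m < l" using s by (auto simp: m_def)
  obtain c where c: "s < c" "c < m"
    "escape_fun l m - escape_fun l s = (m - s) * ((l / c) * (1 / l - c * exp (- c)))"
    using escape_fun_MVT[OF s(1) m(1) \<open>l > 0\<close>] by blast
  obtain d where d: "m < d" "d < l"
    "escape_fun l l - escape_fun l m = (l - m) * ((l / d) * (1 / l - d * exp (- d)))"
    using escape_fun_MVT[of m l l] s m by auto
  have pos: "0 < (m - s) * (l / c)" "0 < (l - m) * (l / d)"
    using s m c d by auto
  have "(m - s) * (l / c) * (1 / l - c * exp (- c)) + (l - m) * (l / d) * (1 / l - d * exp (- d)) = 0"
    using c(3) d(3) eq by (simp add: mult.assoc)
  moreover have "0 \<le> (m - s) * (l / c) * (1 / l - c * exp (- c))"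
    by (rule mult_nonneg_nonneg[OF less_imp_le[OF pos(1)]]) (use le[of c] in simp)
  moreover have "0 \<le> (l - m) * (l / d) * (1 / l - d * exp (- d))"
    by (rule mult_nonneg_nonneg[OF less_imp_le[OF pos(2)]]) (use le[of d] in simp)
  ultimately have "(m - s) * (l / c) * (1 / l - c * exp (- c)) = 0"
    "(l - m) * (l / d) * (1 / l - d * exp (- d)) = 0"
    by linarith+
  with pos have "c * exp (- c) = 1 / l" "d * exp (- d) = 1 / l"
    by (metis mult_eq_0_iff less_irrefl right_minus_eq)+
  with eq1 have "c = d" by metis
  with c d show False by simp
qed

text \<open>\<open>s1\<close> is the local maximum of \<open>escape_fun l\<close>; after it the function decreases and then
  increases up to and beyond \<open>l\<close>.\<close>

lemma escape_fun_le_local_max: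
  assumes l: "l > exp 1" and s1: "0 < s1" "s1 < 1" "s1 * exp (- s1) = 1 / l"
    and s: "0 < s" "s < l" "escape_fun l s = escape_fun l l"
  shows "escape_fun l l \<le> escape_fun l s1"
proof (rule ccontr)
  assume "\<not> escape_fun l l \<le> escape_fun l s1"
  then have less: "escape_fun l s1 < escape_fun l s" using s by simp
  have "l > 0" using s by simp
  have "s \<noteq> s1" using less by auto
  then consider "s < s1" | "s1 < s" by linarith
  then show False
  proof cases
    case 1
    obtain c where c: "s < c" "c < s1"
      "escape_fun l s1 - escape_fun l s = (s1 - s) * ((l / c) * (1 / l - c * exp (- c)))"
      using escape_fun_MVT[OF s(1) 1 \<open>l > 0\<close>] by blast
    have "c * exp (- c) < 1 / l"
      using times_exp_minus_strict_mono[of c s1] c s1 by simp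
    then have "0 \<le> (s1 - s) * ((l / c) * (1 / l - c * exp (- c)))"
      using c s 1 by (intro mult_nonneg_nonneg) auto
    with c(3) less show False by linarith
  next
    case 2
    obtain c where c: "s1 < c" "c < s"
      "escape_fun l s - escape_fun l s1 = (s - s1) * ((l / c) * (1 / l - c * exp (- c)))"
      using escape_fun_MVT[OF s1(1) 2 \<open>l > 0\<close>] by blast
    have "0 < (s - s1) * (l / c) * (1 / l - c * exp (- c))"
      using c(3) less by (simp add: mult.assoc)
    moreover have "0 < (s - s1) * (l / c)"
      using c s1 2 \<open>l > 0\<close> by simp
    ultimately have "0 < 1 / l - c * exp (- c)"
      by (rule zero_less_mult_pos)
    then have lt: "c * exp (- c) < 1 / l" by simp
    \<comment> \<open>Between \<open>s1\<close> and 1 the derivative is negative, so a point of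
      increase beyond \<open>s1\<close> lies at 1 or later. From there on the derivative stays
      positive, against the equal values at \<open>s\<close> and \<open>l\<close>.\<close>
    have "1 \<le> c"
    proof (rule ccontr)
      assume "\<not> 1 \<le> c"
      then show False
        using times_exp_minus_strict_mono[of s1 c] c(1) s1(3) lt by simp
    qed
    obtain d where d: "s < d" "d < l"
      "escape_fun l l - escape_fun l s = (l - s) * ((l / d) * (1 / l - d * exp (- d)))"
      using escape_fun_MVT[OF s(1) s(2) \<open>l > 0\<close>] by blast
    have "d * exp (- d) < 1 / l"
      using times_exp_minus_strict_antimono[of c d] c d \<open>1 \<le> c\<close> lt by simp
    then have "0 < (l - s) * ((l / d) * (1 / l - d * exp (- d)))"
      using d s by (intro mult_pos_pos) auto
    with d(3) s(3) show False by linarith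
  qed
qed

text \<open>If some \<open>s < l\<close> solves the equation, the local maximum is at least as high
  as the value at \<open>l\<close>; conversely \<open>s1\<close> itself serves as the witness, being
  below \<open>l\<close> because \<open>l > 1\<close>.\<close>

lemma E2_poisson_pos_iff_local_max:
  assumes l: "l > exp 1" and s1: "0 < s1" "s1 < 1" "s1 * exp (- s1) = 1 / l"
  shows "E2 (poisson_pmf l) > 0 \<longleftrightarrow> escape_fun l l \<le> escape_fun l s1"
proof -
  have "l > 1"
    using l exp_ge_add_one_self[of 1] by linarith
  then show ?thesis
    using E2_poisson_posD[of l] E2_poisson_posI[of s1 l] escape_fun_le_local_max[OF assms] s1 by auto
qed

text \<open>Parametrising \<open>l = exp s / s\<close> by the position \<open>s < 1\<close> of the local maximum turns the escape
  condition into \<open>escape_gap s \<ge> 0\<close>, which is monotone in \<open>s\<close>.\<close>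

definition escape_gap :: "real \<Rightarrow> real" where
  "escape_gap s = 1 / s + 2 * ln s - s - (exp s / s) * exp (- (exp s / s))"

lemma escape_gap_eq:
  assumes "0 < s" "l = exp s / s"
  shows "escape_gap s = escape_fun l s - escape_fun l l"
proof -
  have "ln l = s - ln s"
    using assms by (simp add: ln_div)
  moreover have "l * exp (- s) = 1 / s"
    using assms by (simp add: exp_minus field_simps)
  ultimately show ?thesis
    using assms(2) by (simp add: escape_gap_def escape_fun_def)
qed

lemma exp_over_self_strict_antimono:
  assumes "0 < s" "s < t" "t \<le> 1"
  shows "exp t / t < exp s / (s::real)"
proof -
  have "inverse (t * exp (- t)) < inverse (s * exp (- s))"
    using times_exp_minus_strict_mono[OF assms(2,3)] assms(1) by (intro less_imp_inverse_less) auto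
  then show ?thesis
    by (simp add: exp_minus divide_inverse mult.commute)
qed

lemma exp_over_self_antimono:
  assumes "0 < s" "s \<le> t" "t \<le> 1"
  shows "exp t / t \<le> exp s / (s::real)"
  using exp_over_self_strict_antimono[of s t] assms by (cases "s = t") auto

text \<open>Both parts decrease. The derivative of \<open>1 / s + 2 * ln s - s\<close> is minus a
  square. The subtracted term is \<open>l * exp (- l)\<close> with \<open>l = exp s / s\<close>,
  which grows because \<open>l\<close> falls while staying at least 1.\<close>

lemma escape_gap_strict_antimono:
  assumes "0 < s" "s < t" "t \<le> 1"
  shows "escape_gap t < escape_gap s"
proof -
  let ?A = "\<lambda>s. 1 / s + 2 * ln s - s"
  have "?A t < ?A s"
  proof (rule DERIV_neg_imp_decreasing_open[OF assms(2)])
    fix x assume "s < x" "x < t"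
    then have x: "0 < x" "x < 1" using assms by auto
    have "0 < (1 / x - 1)\<^sup>2" using x by simp
    moreover have "(?A has_real_derivative - (1 / x - 1)\<^sup>2) (at x)"
      using x by (auto intro!: derivative_eq_intros simp: power2_eq_square field_simps)
    ultimately show "\<exists>y. (?A has_real_derivative y) (at x) \<and> y < 0"
      by (intro exI[of _ "- (1 / x - 1)\<^sup>2"]) simp
  qed (use assms in \<open>auto intro!: continuous_intros\<close>)
  moreover have "1 \<le> exp t / t"
  proof -
    have "t \<le> exp t" using exp_ge_add_one_self[of t] by linarith
    with assms show ?thesis by simp
  qed
  then have "exp s / s * exp (- (exp s / s)) < exp t / t * exp (- (exp t / t))"
    by (rule times_exp_minus_strict_antimono[OF exp_over_self_strict_antimono[OF assms]])
  ultimately show ?thesis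
    by (simp add: escape_gap_def)
qed

lemma escape_gap_le_iff:
  assumes "0 < s" "s \<le> 1" "0 < t" "t \<le> 1"
  shows "escape_gap t \<le> escape_gap s \<longleftrightarrow> s \<le> t"
  using escape_gap_strict_antimono[of s t] escape_gap_strict_antimono[of t s] assms
  by (cases s t rule: linorder_cases) auto

text \<open>The threshold is 3.3185022..., only 2.3e-6 above the lower end of the tolerance; hence the
  long decimals.\<close>

lemma ex_escape_threshold:
  "\<exists>s. 0 < s \<and> s < 1 \<and> escape_gap s = 0 \<and> \<bar>exp s / s - 3.319\<bar> \<le> 0.0005"
proof -
  \<comment> \<open>The right end of the bracket is the delicate one: the gap must already be
    nonpositive while \<open>exp s / s\<close> is still at least 3.3185. The left end has slack, as
    it only has to give \<open>exp s / s \<le> 3.3195\<close>.\<close>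
  have "escape_gap 0.4937138 \<le> 0"
  proof -
    have "ln (0.4937138 :: real) \<le> - 0.70579928"
    proof -
      have "(0.4937138 :: real) \<le> 1 / exp 0.70579928"
        using exp_num_bounds(7) by (simp add: field_simps)
      then have "(0.4937138 :: real) \<le> exp (- 0.70579928)"
        by (simp add: exp_minus inverse_eq_divide)
      from ln_mono[OF this] show ?thesis by simp
    qed
    moreover have "3.318501 / 27.618919 \<le>
        exp (0.4937138 :: real) / 0.4937138 * exp (- (exp 0.4937138 / 0.4937138))"
    proof -
      let ?l = "exp (0.4937138 :: real) / 0.4937138"
      \<comment> \<open>Beyond 1 the function \<open>z * exp (- z)\<close> decreases, so an upper
        bound on \<open>?l\<close> bounds the product from below.\<close>
      have l: "1 \<le> ?l" "?l \<le> 3.318501"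
        using exp_num_bounds(3,4) by (simp_all add: field_simps)
      have "exp (0.82962525 :: real) ^ 4 \<le> 2.2924594802 ^ 4"
        by (intro power_mono exp_num_bounds) auto
      then have "exp (3.318501 :: real) \<le> 27.618919"
        by (simp add: exp_of_nat_mult[symmetric] power_divide)
      then have "3.318501 / 27.618919 \<le> (3.318501 :: real) * exp (- 3.318501)"
        by (simp add: exp_minus field_simps)
      also have "\<dots> \<le> ?l * exp (- ?l)"
        by (rule times_exp_minus_antimono[OF l(2,1)])
      finally show ?thesis .
    qed
    ultimately have "escape_gap 0.4937138 \<le>
        1 / 0.4937138 + 2 * (- 0.70579928) - 0.4937138 - 3.318501 / 27.618919"
      unfolding escape_gap_def by linarith
    also have "\<dots> \<le> 0" by simp
    finally show ?thesis .
  qed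
  moreover have "0 \<le> escape_gap 0.4937"
  proof -
    have "- 0.70582724 \<le> ln (0.4937 :: real)"
    proof -
      have "1 / exp 0.70582724 \<le> (0.4937 :: real)"
        using exp_num_bounds(8) by (simp add: field_simps)
      then have "exp (- 0.70582724) \<le> (0.4937 :: real)"
        by (simp add: exp_minus inverse_eq_divide)
      from ln_mono[OF this] show ?thesis by simp
    qed
    moreover have "exp (0.4937 :: real) / 0.4937 * exp (- (exp 0.4937 / 0.4937)) \<le> 3.31854 / 27.6199"
    proof -
      let ?l = "exp (0.4937 :: real) / 0.4937"
      have l: "3.31854 \<le> ?l"
        using exp_num_bounds(6) by (simp add: field_simps)
      have "2.29248183 ^ 4 \<le> exp (0.829635 :: real) ^ 4"
        by (intro power_mono exp_num_bounds) auto
      then have e: "27.6199 \<le> exp (3.31854 :: real)"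
        by (simp add: exp_of_nat_mult[symmetric] power_divide)
      have "?l * exp (- ?l) \<le> 3.31854 * exp (- 3.31854)"
        by (rule times_exp_minus_antimono[OF l]) simp
      also have "\<dots> \<le> 3.31854 / 27.6199"
        using e by (simp add: exp_minus field_simps)
      finally show ?thesis .
    qed
    ultimately have "1 / 0.4937 + 2 * (- 0.70582724) - 0.4937 - 3.31854 / 27.6199 \<le> escape_gap 0.4937"
      unfolding escape_gap_def by linarith
    moreover have "(0::real) \<le> 1 / 0.4937 + 2 * (- 0.70582724) - 0.4937 - 3.31854 / 27.6199"
      by simp
    ultimately show ?thesis by linarith
  qed
  moreover have "continuous_on {0.4937..0.4937138} escape_gap"
    unfolding escape_gap_def by (intro continuous_intros) auto
  ultimately obtain s where s: "0.4937 \<le> s" "s \<le> 0.4937138" "escape_gap s = 0"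
    using IVT2'[of escape_gap "0.4937138" 0 "0.4937"] by auto
  have "exp s / s \<le> exp 0.4937 / 0.4937"
    by (rule exp_over_self_antimono) (use s in simp_all)
  also have "\<dots> \<le> 3.3195"
    using exp_num_bounds(5) by (simp add: field_simps)
  finally have upper: "exp s / s \<le> 3.3195" .
  have "3.3185 \<le> exp (0.4937138 :: real) / 0.4937138"
    using exp_num_bounds(4) by (simp add: field_simps)
  also have "\<dots> \<le> exp s / s"
    by (rule exp_over_self_antimono) (use s in simp_all)
  finally have "3.3185 \<le> exp s / s" .
  with upper have "\<bar>exp s / s - 3.319\<bar> \<le> 0.0005"
    unfolding abs_le_iff by simp
  with s show ?thesis
    by (intro exI[of _ s]) auto
qed

text \<open>Up to \<open>exp 1\<close> only the trivial solution exists. Above it,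
  \<open>l = exp x / x\<close> with \<open>x < 1\<close> the position of the local maximum, and
  monotonicity of \<open>escape_gap\<close> and of \<open>exp x / x\<close> translates the criterion
  back to \<open>l\<close>.\<close>

lemma E2_poisson_pos_iff:
  assumes s: "0 < s" "s < 1" "escape_gap s = 0" and l: "0 < l"
  shows "E2 (poisson_pmf l) > 0 \<longleftrightarrow> exp s / s \<le> l"
proof (cases "l \<le> exp 1")
  case True
  then have "\<not> E2 (poisson_pmf l) > 0"
    using E2_poisson_posD[OF l] escape_fun_neq_if_le_exp_1 by blast
  moreover have "exp 1 < exp s / s"
    using exp_over_self_strict_antimono[of s 1] s by simp
  ultimately show ?thesis using True by linarith
next
  case False
  then have l1: "l > exp 1" by simp
  have "\<exists>x\<ge>0. x \<le> 1 \<and> x * exp (- x) = 1 / l"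
    using l1 l by (intro IVT' continuous_intros) (auto simp: exp_minus field_simps)
  then obtain x where x: "0 \<le> x" "x \<le> 1" "x * exp (- x) = 1 / l" by blast
  have "x \<noteq> 0" using x(3) l by auto
  moreover have "x \<noteq> 1"
  proof
    assume "x = 1"
    with x(3) l have "l = exp 1" by (simp add: exp_minus field_simps)
    with l1 show False by simp
  qed
  ultimately have x01: "0 < x" "x < 1" using x by auto
  have lx: "l = exp x / x"
    using x(3) x01 l by (simp add: exp_minus field_simps)
  have "E2 (poisson_pmf l) > 0 \<longleftrightarrow> escape_gap s \<le> escape_gap x"
    unfolding E2_poisson_pos_iff_local_max[OF l1 x01 x(3)] escape_gap_eq[OF x01(1) lx] s(3) by simp
  also have "\<dots> \<longleftrightarrow> x \<le> s"
    using escape_gap_le_iff[of x s] x01 s by simp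
  also have "\<dots> \<longleftrightarrow> exp s / s \<le> l"
    unfolding lx using exp_over_self_strict_antimono[of x s] exp_over_self_strict_antimono[of s x] x01 s
    by (cases x s rule: linorder_cases) auto
  finally show ?thesis .
qed

lemma E_poisson_jump:
  assumes s: "0 < s" "s < 1" "escape_gap s = 0"
  shows "\<not> isCont (\<lambda>l. E1 (poisson_pmf l)) (exp s / s)"
    and "\<not> isCont (\<lambda>l. E2 (poisson_pmf l)) (exp s / s)"
proof -
  have pos: "exp s / s > 0" using s by simp
  have 0: "E1 (poisson_pmf l) = 0" "E2 (poisson_pmf l) = 0" if "0 < l" "l < exp s / s" for l
    using E2_poisson_pos_iff[OF s that(1)] E_poisson_pos_iff[OF that(1)] that(2)
      E_bounds[of "poisson_pmf l"] by linarith+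
  have "E2 (poisson_pmf (exp s / s)) > 0"
    using E2_poisson_pos_iff[OF s pos] by blast
  then have "E1 (poisson_pmf (exp s / s)) > 0"
    using E_poisson_pos_iff[OF pos] by blast
  then show "\<not> isCont (\<lambda>l. E1 (poisson_pmf l)) (exp s / s)"
    using 0 pos by (intro not_isCont_jump[of _ _ 0])
  show "\<not> isCont (\<lambda>l. E2 (poisson_pmf l)) (exp s / s)"
    using 0 pos \<open>E2 (poisson_pmf (exp s / s)) > 0\<close> by (intro not_isCont_jump[of _ _ 0])
qed

section \<open>The phase transitions\<close>

text \<open>Trades the real powers of the statement for a cube root \<open>q\<close> of 2, which
  polynomial algebra can handle; the first exponent splits as
  \<open>5 / 3 = 2 - 1 / 3\<close>.\<close>

lemma binary_threshold:
  obtains q :: real where "q ^ 3 = 2" "0 < q" "3 / 2 powr (5 / 3) = 3 * q / 4"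
    "2 powr (4 / 3) / 3 = 2 * q / 3" "3 * q / 4 \<le> 1"
proof
  let ?q = "2 powr (1 / 3) :: real"
  show q3: "?q ^ 3 = 2" "0 < ?q"
    by (simp_all add: powr_realpow[symmetric] powr_powr)
  have "(2::real) powr (5 / 3) = 2 powr (2 + - 1 / 3)" by simp
  also have "\<dots> = 4 / ?q"
    by (simp only: powr_add) (simp add: powr_minus_divide)
  finally show "3 / 2 powr (5 / 3) = 3 * ?q / 4" by simp
  have "(2::real) powr (4 / 3) = 2 powr (1 + 1 / 3)" by simp
  then show "2 powr (4 / 3) / 3 = 2 * ?q / 3"
    by (simp only: powr_add) simp
  show "3 * ?q / 4 \<le> 1"
  proof (rule ccontr)
    assume "\<not> 3 * ?q / 4 \<le> 1"
    then have "(4 / 3) ^ 3 \<le> ?q ^ 3" by (intro power_mono) auto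
    then show False unfolding q3 by (simp add: power3_eq_cube)
  qed
qed

theorem proposition3:
  shows
    "(\<comment> \<open>binary branching\<close>
      (\<forall>t\<in>{0..1}. D_normal (binary_pmf t) > 0 \<longleftrightarrow> t > sqrt 3 / 2) \<and>
      ((\<lambda>t. D_normal (binary_pmf t)) \<longlongrightarrow> 0) (at_right (sqrt 3 / 2)) \<and>
      (\<forall>t\<in>{0..1}. D_misere (binary_pmf t) > 0 \<longleftrightarrow> t > 3 / 4) \<and>
      ((\<lambda>t. D_misere (binary_pmf t)) \<longlongrightarrow> 0) (at_right (3 / 4)) \<and>
      (let te = 3 / 2 powr (5 / 3) in
        (\<forall>t\<in>{0..1}. (E1 (binary_pmf t) > 0 \<longleftrightarrow> E2 (binary_pmf t) > 0) \<and>
                    (E2 (binary_pmf t) > 0 \<longleftrightarrow> t \<ge> te)) \<and>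
        \<not> isCont (\<lambda>t. E1 (binary_pmf t)) te \<and>
        \<not> isCont (\<lambda>t. E2 (binary_pmf t)) te \<and>
        E1 (binary_pmf te) = 2 powr (4 / 3) / 3)) \<and>
     (\<comment> \<open>Poisson offspring\<close>
      (\<forall>l>0. D_normal (poisson_pmf l) > 0 \<longleftrightarrow> l > exp 1) \<and>
      ((\<lambda>l. D_normal (poisson_pmf l)) \<longlongrightarrow> 0) (at_right (exp 1)) \<and>
      (\<exists>lm::real.
        (\<forall>l>0. l = exp (1 - l * exp (- l)) \<longleftrightarrow> l = lm) \<and>
        \<bar>lm - 2.103\<bar> \<le> 0.0005 \<and>
        (\<forall>l>0. D_misere (poisson_pmf l) > 0 \<longleftrightarrow> l > lm) \<and>
        ((\<lambda>l. D_misere (poisson_pmf l)) \<longlongrightarrow> 0) (at_right lm)) \<and>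
      (\<exists>le::real.
        \<bar>le - 3.319\<bar> \<le> 0.0005 \<and>
        (\<forall>l>0. (E1 (poisson_pmf l) > 0 \<longleftrightarrow> E2 (poisson_pmf l) > 0) \<and>
               (E2 (poisson_pmf l) > 0 \<longleftrightarrow> l \<ge> le)) \<and>
        \<not> isCont (\<lambda>l. E1 (poisson_pmf l)) le \<and>
        \<not> isCont (\<lambda>l. E2 (poisson_pmf l)) le)) \<and>
     (\<comment> \<open>geometric offspring: \<open>pmf (geometric_pmf (1 - \<alpha>)) i = \<alpha> ^ i * (1 - \<alpha>)\<close>\<close>
      \<forall>\<alpha>\<in>{0<..<1}. D_normal (geometric_pmf (1 - \<alpha>)) = 0 \<and>
                  D_misere (geometric_pmf (1 - \<alpha>)) = 0 \<and>
                  E1 (geometric_pmf (1 - \<alpha>)) = 0 \<and>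
                  E2 (geometric_pmf (1 - \<alpha>)) = 0)"
proof (intro conjI)
  show "\<forall>t\<in>{0..1}. D_normal (binary_pmf t) > 0 \<longleftrightarrow> t > sqrt 3 / 2"
    using D_normal_binary_pos_iff by simp
  show "((\<lambda>t. D_normal (binary_pmf t)) \<longlongrightarrow> 0) (at_right (sqrt 3 / 2))"
    by (rule D_normal_binary_tendsto)
  show "\<forall>t\<in>{0..1}. D_misere (binary_pmf t) > 0 \<longleftrightarrow> t > 3 / 4"
    using D_misere_binary_pos_iff by simp
  show "((\<lambda>t. D_misere (binary_pmf t)) \<longlongrightarrow> 0) (at_right (3 / 4))"
    by (rule D_misere_binary_tendsto)
  obtain q :: real where q: "q ^ 3 = 2" "0 < q" and te: "3 / 2 powr (5 / 3) = 3 * q / 4"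
    and E: "2 powr (4 / 3) / 3 = 2 * q / 3" and le: "3 * q / 4 \<le> 1"
    by (rule binary_threshold)
  show "let te = 3 / 2 powr (5 / 3) in
        (\<forall>t\<in>{0..1}. (E1 (binary_pmf t) > 0 \<longleftrightarrow> E2 (binary_pmf t) > 0) \<and>
                    (E2 (binary_pmf t) > 0 \<longleftrightarrow> t \<ge> te)) \<and>
        \<not> isCont (\<lambda>t. E1 (binary_pmf t)) te \<and>
        \<not> isCont (\<lambda>t. E2 (binary_pmf t)) te \<and>
        E1 (binary_pmf te) = 2 powr (4 / 3) / 3"
    unfolding Let_def te E
    using E_binary_jump[OF q le] E1_binary_critical[OF q le] E_binary_pos_iff E1_binary_pos_iff[OF q]
    by auto
  show "\<forall>l>0. D_normal (poisson_pmf l) > 0 \<longleftrightarrow> l > exp 1"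
    using D_normal_poisson_pos_iff by blast
  show "((\<lambda>l. D_normal (poisson_pmf l)) \<longlongrightarrow> 0) (at_right (exp 1))"
    by (rule D_normal_poisson_tendsto)
  obtain m :: real where m: "\<bar>m - 2.103\<bar> \<le> 0.0005" "ln m + m * exp (- m) = 1"
    using ex_misere_threshold by blast
  have "m > 0" using m(1) by (simp only: abs_le_iff) simp
  note thr = misere_threshold[OF \<open>m > 0\<close> m(2)]
  have "exp (m * exp (- m)) * m = exp 1"
    using \<open>m > 0\<close> by (subst m(2)[symmetric]) (simp add: exp_add)
  then have "m * exp (m * exp (- m)) = exp 1" by (simp only: mult.commute)
  then have "((\<lambda>l. D_misere (poisson_pmf l)) \<longlongrightarrow> 0) (at_right m)"
    by (rule D_misere_poisson_tendsto[OF \<open>m > 0\<close>])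
  then show "\<exists>lm::real.
        (\<forall>l>0. l = exp (1 - l * exp (- l)) \<longleftrightarrow> l = lm) \<and>
        \<bar>lm - 2.103\<bar> \<le> 0.0005 \<and>
        (\<forall>l>0. D_misere (poisson_pmf l) > 0 \<longleftrightarrow> l > lm) \<and>
        ((\<lambda>l. D_misere (poisson_pmf l)) \<longlongrightarrow> 0) (at_right lm)"
    using m(1) thr D_misere_poisson_pos_iff by blast
  obtain s where s: "0 < s" "s < 1" "escape_gap s = 0" and approx: "\<bar>exp s / s - 3.319\<bar> \<le> 0.0005"
    using ex_escape_threshold by blast
  show "\<exists>le::real.
        \<bar>le - 3.319\<bar> \<le> 0.0005 \<and>
        (\<forall>l>0. (E1 (poisson_pmf l) > 0 \<longleftrightarrow> E2 (poisson_pmf l) > 0) \<and>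
               (E2 (poisson_pmf l) > 0 \<longleftrightarrow> l \<ge> le)) \<and>
        \<not> isCont (\<lambda>l. E1 (poisson_pmf l)) le \<and>
        \<not> isCont (\<lambda>l. E2 (poisson_pmf l)) le"
    using approx E_poisson_pos_iff E2_poisson_pos_iff[OF s] E_poisson_jump[OF s] by blast
  show "\<forall>\<alpha>\<in>{0<..<1}. D_normal (geometric_pmf (1 - \<alpha>)) = 0 \<and>
                  D_misere (geometric_pmf (1 - \<alpha>)) = 0 \<and>
                  E1 (geometric_pmf (1 - \<alpha>)) = 0 \<and>
                  E2 (geometric_pmf (1 - \<alpha>)) = 0"
    using geometric_no_draw geometric_no_escape by simp
qed

end
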